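(* Let $k\ge 3$ be an integer and $m=2k-1$. The following statements hold. (1) For every integer $c\ge m-1$, \[ \delta_{\chi}(C_{m},c)\le\frac{2(m-1)}{2m(m-1)+1}. \] (2) Let $c\ge 4$ be an integer and $r=2\lfloor c/2\rfloor$. Then \[ \delta_{\chi}(\{C_{3},C_{5}\},c)\le\frac{2r}{2r(r+1)+1}. \] (3) For every integer $c\ge 2$, \[ \delta_{\chi}(C_{m},c) \ge\delta_{\chi}(\mathcal{C}_{m},c) \ge\frac{1}{2\left((k-1)^{c-2}(2k-1)+\frac{(k-1)^{c-2}-1}{k-2}\right)}. \]
   Context: Graphs are finite, simple and loopless. $\delta(G)$ is the minimum degree of $G$ and $C_\ell$ is the cycle of length $\ell$. For a family $\mathcal{F}$ of graphs, a graph is $\mathcal{F}$-free if it contains no (not necessarily induced) subgraph isomorphic to a member of $\mathcal{F}$; for a single graph $H$, $H$-free means $\{H\}$-free. For odd $m\ge 3$, $\mathcal{C}_m=\{C_3,C_5,\ldots,C_m\}$. For a graph or a family of graphs $\mathcal{F}$ and an integer $c\ge 2$, $\delta_\chi(\mathcal{F},c)$ is the infimum of all $\alpha$ such that, for every $\varepsilon>0$, every sufficiently large $\mathcal{F}$-free graph $G$ with $\delta(G)\ge(\alpha+\varepsilon)|V(G)|$ is $c$-colorable (has a proper coloring with $c$ colors). *)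

theory Defs
  imports Complex_Main
begin

datatype 'a graph = Graph (verts: "'a set") (edges: "'a set set")

definition simple_graph :: "'a graph \<Rightarrow> bool" where
  "simple_graph G \<longleftrightarrow> finite (verts G) \<and> (\<forall>e\<in>edges G. e \<subseteq> verts G \<and> card e = 2)"

definition degree :: "'a graph \<Rightarrow> 'a \<Rightarrow> nat" where
  "degree G v = card {e \<in> edges G. v \<in> e}"

(* Unspecified for the graph without vertices. *)
definition min_degree :: "'a graph \<Rightarrow> nat" where
  "min_degree G = Min (degree G ` verts G)"

definition colorable :: "'a graph \<Rightarrow> nat \<Rightarrow> bool" where
  "colorable G c \<longleftrightarrow>
     (\<exists>f :: 'a \<Rightarrow> nat. (\<forall>v\<in>verts G. f v < c) \<and>
        (\<forall>u v. {u, v} \<in> edges G \<longrightarrow> f u \<noteq> f v))"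

definition subgraph :: "'a graph \<Rightarrow> 'a graph \<Rightarrow> bool" where
  "subgraph S G \<longleftrightarrow> verts S \<subseteq> verts G \<and> edges S \<subseteq> edges G"

definition isomorphic :: "'a graph \<Rightarrow> 'b graph \<Rightarrow> bool" where
  "isomorphic G H \<longleftrightarrow>
     (\<exists>f. bij_betw f (verts G) (verts H) \<and> edges H = (\<lambda>e. f ` e) ` edges G)"

definition free_of :: "'b graph set \<Rightarrow> 'a graph \<Rightarrow> bool" where
  "free_of \<F> G \<longleftrightarrow>
     \<not> (\<exists>H\<in>\<F>. \<exists>S. simple_graph S \<and> subgraph S G \<and> isomorphic H S)"

(* The cycle of length l; a simple graph only for l \<ge> 3. *)
definition cycle_graph :: "nat \<Rightarrow> nat graph" where
  "cycle_graph l = Graph {..<l} {{i, Suc i mod l} | i. i < l}"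

definition odd_cycles :: "nat \<Rightarrow> nat graph set" where
  "odd_cycles m = {cycle_graph l | l. odd l \<and> 3 \<le> l \<and> l \<le> m}"

(* Vertices are natural numbers: every finite graph is isomorphic to such a graph. The
   set below is upward closed and contains 1. It is bounded below, so that Inf is its
   infimum, exactly when there are arbitrarily large non-c-colorable \<F>-free graphs;
   this is the case for families of odd cycles. *)
definition delta_chi :: "nat graph set \<Rightarrow> nat \<Rightarrow> real" where
  "delta_chi \<F> c = Inf {\<alpha> :: real. \<forall>\<epsilon>>0. \<exists>n\<^sub>0. \<forall>G :: nat graph.
     simple_graph G \<and> card (verts G) \<ge> n\<^sub>0 \<and> free_of \<F> G \<and>
     real (min_degree G) \<ge> (\<alpha> + \<epsilon>) * real (card (verts G))
     \<longrightarrow> colorable G c}"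

end

theory Submission
  imports Defs "HOL-Library.Z2" "HOL-Library.Multiset" "HOL-Library.Countable" "HOL-Library.Ramsey"
begin

text \<open>
  Upper bounds. Let G be a C_m-free graph on n vertices of minimum degree d, and call two vertices
  linked if they have at least h common neighbours, where h is a small multiple of n. Ramsey's
  theorem yields paths of every small even length between linked vertices, so no three edges in a
  row have linked ends, and vertices with a common linked vertex are not adjacent. If p is the
  largest number of pairwise unlinked vertices possible, colouring by linked vertices of a maximal
  unlinked set uses p colours. If p - 1 colours do not suffice, any two colours of any such
  set are joined by an edge whose ends are linked to nothing else in the set, and counting
  neighbourhoods shows that the vertices fall into p cliques of the linking relation. Colouring by
  the clique in which a vertex has two neighbours is also proper; as it cannot be compressed
  either, the cliques are matched in pairs, so p is even. This gives the threshold
  (p + 1) / (p^2 + p + 1), which is below the one required.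

  Lower bound. Starting from an edge, iterate the generalised Mycielski construction with k - 1
  levels and an apex. It keeps the odd girth above m, and a total dominating set of size s becomes
  one of size (k - 1) s + 1; adding many copies of the dominating vertices makes the minimum degree
  linear. The chromatic number grows by one in each step: the box complex contains a mod-2
  antipodal sphere of one dimension more (a cylinder closed by a cone at the apex), and by Fan's
  parity argument a proper colouring has an odd number of simplices with alternating signs, hence
  with pairwise distinct colours.
\<close>

subsection \<open>Neighbourhoods\<close>

definition neighbors :: "'a graph \<Rightarrow> 'a \<Rightarrow> 'a set" where
  "neighbors G v = {u. {v, u} \<in> edges G}"

lemma degree_eq_card_neighbors:
  assumes "simple_graph G"
  shows "degree G v = card (neighbors G v)"
proof -
  have "{e \<in> edges G. v \<in> e} = (\<lambda>u. {v, u}) ` neighbors G v"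
  proof (intro equalityI subsetI)
    fix e assume e: "e \<in> {e \<in> edges G. v \<in> e}"
    then have "card e = 2" using assms by (auto simp: simple_graph_def)
    then obtain a b where "e = {a, b}" by (auto simp: card_2_iff)
    with e show "e \<in> (\<lambda>u. {v, u}) ` neighbors G v"
      by (auto simp: neighbors_def insert_commute)
  qed (auto simp: neighbors_def)
  moreover have "inj_on (\<lambda>u. {v, u}) (neighbors G v)"
    by (auto simp: inj_on_def doubleton_eq_iff)
  ultimately show ?thesis by (simp add: degree_def card_image)
qed

lemma neighbors_subset:
  assumes "simple_graph G"
  shows "neighbors G v \<subseteq> verts G"
  using assms by (auto simp: neighbors_def simple_graph_def)

lemma finite_neighbors: "simple_graph G \<Longrightarrow> finite (neighbors G v)"
  by (meson finite_subset neighbors_subset simple_graph_def)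

definition codegree :: "'a graph \<Rightarrow> 'a \<Rightarrow> 'a \<Rightarrow> nat" where
  "codegree G u v = card (neighbors G u \<inter> neighbors G v)"

lemma codegree_commute: "codegree G u v = codegree G v u"
  by (simp add: codegree_def Int_commute)

subsection \<open>Linked vertices in graphs without an odd cycle\<close>

lemma cycle_of_list:
  assumes simple: "simple_graph G" and xs: "distinct xs" "length xs = m" "m \<ge> 3"
    and path: "successively (\<lambda>u v. {u, v} \<in> edges G) xs" and closing: "{last xs, hd xs} \<in> edges G"
  shows "\<not> free_of {cycle_graph m} G"
proof -
  define S where "S = Graph (set xs) ((`) ((!) xs) ` edges (cycle_graph m))"
  have edge: "{xs ! i, xs ! (Suc i mod m)} \<in> edges G" if "i < m" for i
  proof (cases "Suc i < m")
    case True
    then show ?thesis using path xs(2) by (simp add: successively_conv_nth)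
  next
    case False
    then have "m = Suc i" "xs \<noteq> []" using that xs by auto
    then show ?thesis using closing xs(2) by (simp add: last_conv_nth hd_conv_nth)
  qed
  then have sub: "edges S \<subseteq> edges G"
    by (auto simp: S_def cycle_graph_def)
  have "verts S \<subseteq> verts G"
  proof
    fix x assume "x \<in> verts S"
    then obtain i where "i < m" "x = xs ! i" using xs by (auto simp: S_def in_set_conv_nth)
    with edge[of i] simple show "x \<in> verts G" by (auto simp: simple_graph_def)
  qed
  with sub have "subgraph S G" by (simp add: subgraph_def)
  moreover have "simple_graph S"
  proof -
    have "e \<subseteq> set xs" if e: "e \<in> edges S" for e
    proof -
      obtain i where "i < m" "e = {xs ! i, xs ! (Suc i mod m)}"
        using e by (auto simp: S_def cycle_graph_def)
      moreover have "Suc i mod m < m" using xs(3) by simp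
      ultimately show ?thesis using xs(2) by simp
    qed
    then show ?thesis
      using sub simple unfolding simple_graph_def by (auto simp: S_def)
  qed
  moreover have "isomorphic (cycle_graph m) S"
    unfolding isomorphic_def
    by (rule exI[of _ "(!) xs"])
      (use xs in \<open>auto simp: S_def cycle_graph_def intro!: bij_betw_nth\<close>)
  ultimately show ?thesis unfolding free_of_def by blast
qed

text \<open>Greedy from the last entry backwards: a fresh common neighbour is put between
  consecutive entries of \<open>qs\<close>. At each stage \<open>F\<close>, the head and the path
  built so far have fewer elements than the common neighbourhood.\<close>

lemma interleaved_path:
  assumes simple: "simple_graph G" and "qs \<noteq> []" "distinct qs" "set qs \<inter> F = {}" "finite F"
    and "\<And>x y. x \<in> set qs \<Longrightarrow> y \<in> set qs \<Longrightarrow> x \<noteq> y \<Longrightarrow> card F + 2 * length qs \<le> codegree G x y"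
  shows "\<exists>ps. successively (\<lambda>u v. {u, v} \<in> edges G) ps \<and> ps \<noteq> [] \<and> hd ps = hd qs \<and>
    last ps = last qs \<and> distinct ps \<and> set ps \<inter> F = {} \<and> length ps = 2 * length qs - 1"
  using assms(2-)
proof (induction qs arbitrary: F rule: induct_list012)
  case (2 x)
  then show ?case by (intro exI[of _ "[x]"]) simp
next
  case (3 x y qs)
  \<comment> \<open>The rest of the path must also avoid \<open>x\<close>: the forbidden set grows
    by one while \<open>2 * length qs\<close> drops by two.\<close>
  have "\<exists>ps. successively (\<lambda>u v. {u, v} \<in> edges G) ps \<and> ps \<noteq> [] \<and> hd ps = hd (y # qs) \<and>
    last ps = last (y # qs) \<and> distinct ps \<and> set ps \<inter> insert x F = {}
    \<and> length ps = 2 * length (y # qs) - 1"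
  proof (rule "3.IH"(2))
    fix u v assume "u \<in> set (y # qs)" "v \<in> set (y # qs)" "u \<noteq> v"
    then have "card F + 2 * length (x # y # qs) \<le> codegree G u v"
      by (intro "3.prems") auto
    moreover have "card (insert x F) \<le> Suc (card F)"
      by (rule card_insert_le_m1) simp_all
    ultimately show "card (insert x F) + 2 * length (y # qs) \<le> codegree G u v" by simp
  qed (use "3.prems" in auto)
  then obtain ps where ps: "successively (\<lambda>u v. {u, v} \<in> edges G) ps" "ps \<noteq> []" "hd ps = y"
    "last ps = last (y # qs)" "distinct ps" "set ps \<inter> insert x F = {}"
    "length ps = 2 * length qs + 1"
    by auto
  have "card (insert x F \<union> set ps) < codegree G x y"
  proof -
    have "card (insert x F \<union> set ps) \<le> Suc (card F) + length ps"
      by (intro order.trans[OF card_Un_le] add_mono card_length card_insert_le_m1) simp_all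
    moreover have "card F + 2 * length (x # y # qs) \<le> codegree G x y"
      using "3.prems" by (intro "3.prems") auto
    ultimately show ?thesis using ps(7) by simp
  qed
  then have "\<not> neighbors G x \<inter> neighbors G y \<subseteq> insert x F \<union> set ps"
    unfolding codegree_def using "3.prems"(4)
    by (metis card_mono finite_UnI finite_insert List.finite_set leD)
  then obtain z where z: "{x, z} \<in> edges G" "{y, z} \<in> edges G" "z \<noteq> x" "z \<notin> F" "z \<notin> set ps"
    by (auto simp: neighbors_def)
  with ps "3.prems" show ?case
    by (intro exI[of _ "x # z # ps"]) (auto simp: successively_Cons insert_commute)
qed simp

lemma colorableI:
  assumes "finite C" "card C \<le> c" "\<And>v. v \<in> verts G \<Longrightarrow> f v \<in> C"
    and "\<And>u v. {u, v} \<in> edges G \<Longrightarrow> f u \<noteq> f v" "simple_graph G"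
  shows "colorable G c"
proof -
  obtain b where b: "bij_betw b C {0..<card C}"
    using ex_bij_betw_finite_nat[OF assms(1)] by blast
  have "b (f u) \<noteq> b (f v)" if "{u, v} \<in> edges G" for u v
  proof -
    have "u \<in> verts G" "v \<in> verts G" using that assms(5) by (auto simp: simple_graph_def)
    with assms(3,4) that b show ?thesis by (meson bij_betw_imp_inj_on inj_onD)
  qed
  moreover have "b (f v) < c" if "v \<in> verts G" for v
    using bij_betwE[OF b] assms(2,3) that by fastforce
  ultimately show ?thesis unfolding colorable_def by (intro exI[of _ "\<lambda>v. b (f v)"]) auto
qed

lemma even_card_involution:
  assumes "finite Y" "\<And>y. y \<in> Y \<Longrightarrow> \<tau> y \<in> Y \<and> \<tau> y \<noteq> y \<and> \<tau> (\<tau> y) = y"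
  shows "even (card Y)"
  using assms
proof (induction "card Y" arbitrary: Y rule: less_induct)
  case less
  show ?case
  proof (cases "Y = {}")
    case False
    then obtain y where y: "y \<in> Y" by blast
    define Z where "Z = Y - {y, \<tau> y}"
    have \<tau>y: "\<tau> y \<in> Y" "\<tau> y \<noteq> y" "\<tau> (\<tau> y) = y" using less(3) y by auto
    have card: "card Y = card Z + 2"
      using card_Diff_subset[of "{y, \<tau> y}" Y] card_mono[of Y "{y, \<tau> y}"] less(2) y \<tau>y
      by (auto simp: Z_def)
    moreover have "even (card Z)"
    proof (rule less(1))
      fix z assume z: "z \<in> Z"
      then have "\<tau> z \<noteq> y" "\<tau> z \<noteq> \<tau> y" using less(3) \<tau>y unfolding Z_def by force+
      with z less(3) show "\<tau> z \<in> Z \<and> \<tau> z \<noteq> z \<and> \<tau> (\<tau> z) = z" by (auto simp: Z_def)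
    qed (use less(2) card in \<open>auto simp: Z_def\<close>)
    ultimately show ?thesis by simp
  qed simp
qed

text \<open>By \<open>linked_pair\<close>, the independent alternative of \<open>ramsey\<close>
  cannot occur for the graph of linked pairs, so any \<open>r\<close> vertices of \<open>G\<close>
  contain \<open>m\<close> pairwise linked ones. The bound on \<open>h\<close> leaves
  \<open>r\<close> common neighbours beside \<open>m\<close> forbidden vertices, leaves room for
  interleaving up to \<open>m\<close> vertices, and makes \<open>h\<close> exceed
  \<open>p\<close>.\<close>

locale odd_cycle_free_graph =
  fixes G :: "'a graph" and m p h r :: nat
  assumes simple: "simple_graph G" and free: "free_of {cycle_graph m} G"
    and m: "odd m" "m \<ge> 5"
    and ramsey: "\<And>V :: 'a set. \<And>E. finite V \<Longrightarrow> card V \<ge> r \<Longrightarrow>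
      \<exists>R \<subseteq> V. card R = m \<and> clique R E \<or> card R = Suc p \<and> indep R E"
    and linked_pair: "\<And>Y. Y \<subseteq> verts G \<Longrightarrow> card Y = Suc p \<Longrightarrow>
      \<exists>x\<in>Y. \<exists>y\<in>Y. x \<noteq> y \<and> h \<le> codegree G x y"
    and h: "h \<ge> r + 4 * m + 2 * p + 5"
begin

abbreviation N :: "'a \<Rightarrow> 'a set" where "N \<equiv> neighbors G"
abbreviation linked :: "'a \<Rightarrow> 'a \<Rightarrow> bool" where "linked u v \<equiv> h \<le> codegree G u v"
abbreviation adj :: "'a \<Rightarrow> 'a \<Rightarrow> bool" where "adj u v \<equiv> {u, v} \<in> edges G"

lemma linked_commute: "linked u v \<longleftrightarrow> linked v u"
  by (simp add: codegree_commute)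

lemma adj_verts: "adj u v \<Longrightarrow> u \<in> verts G \<and> v \<in> verts G \<and> u \<noteq> v"
  using simple by (auto simp: simple_graph_def)

text \<open>Ramsey's theorem inside the common neighbourhood of \<open>u\<close> and
  \<open>w\<close> gives pairwise linked vertices; \<open>s\<close> of them, interleaved with fresh
  vertices, are the interior of a path of length \<open>2 * s\<close>. Callers put \<open>u\<close>
  and \<open>w\<close> into \<open>F\<close> to keep the path away from its ends.\<close>

lemma linked_path:
  assumes "linked u w" "finite F" "card F \<le> m" "1 \<le> s" "s \<le> m"
  shows "\<exists>ps. distinct ps \<and> ps \<noteq> [] \<and> set ps \<inter> F = {} \<and> length ps = 2 * s - 1 \<and>
    successively adj ps \<and> adj u (hd ps) \<and> adj (last ps) w"
proof -
  define A where "A = N u \<inter> N w - F"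
  have fin: "finite A" using finite_neighbors[OF simple] by (auto simp: A_def)
  have "card A \<ge> codegree G u w - card F"
    unfolding A_def codegree_def by (rule diff_card_le_card_Diff) fact
  then have "card A \<ge> r" using assms h by linarith
  then obtain R where R: "R \<subseteq> A" "card R = m \<and> clique R {{x, y} | x y. linked x y}
      \<or> card R = Suc p \<and> indep R {{x, y} | x y. linked x y}"
    using ramsey[OF fin] by meson
  have "A \<subseteq> verts G" using neighbors_subset[OF simple] by (auto simp: A_def)
  then have "\<not> (card R = Suc p \<and> indep R {{x, y} | x y. linked x y})"
    using linked_pair[of R] R(1) unfolding indep_def by blast
  with R have "card R = m" and clique: "clique R {{x, y} | x y. linked x y}" by auto
  then obtain R' where R': "R' \<subseteq> R" "card R' = s"
    using obtain_subset_with_card_n assms(5) by metis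
  have "finite R'" using R' R(1) fin by (meson finite_subset)
  then obtain qs where qs: "set qs = R'" "distinct qs" using finite_distinct_list by blast
  then have len: "length qs = s" using R' distinct_card by fastforce
  have "linked x y" if "x \<in> set qs" "y \<in> set qs" "x \<noteq> y" for x y
  proof -
    have "{x, y} \<in> {{x, y} | x y. linked x y}"
      using clique that qs R' unfolding clique_def by blast
    then show ?thesis by (auto simp: doubleton_eq_iff linked_commute)
  qed
  moreover have "card F + 2 * length qs \<le> h"
    using assms h len by linarith
  ultimately have big: "card F + 2 * length qs \<le> codegree G x y"
    if "x \<in> set qs" "y \<in> set qs" "x \<noteq> y" for x y
    using that by (meson order.trans)
  have "qs \<noteq> []" using len assms(4) by auto
  moreover have "set qs \<inter> F = {}" using qs R' R(1) by (auto simp: A_def)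
  ultimately obtain ps where ps: "successively adj ps" "ps \<noteq> []" "hd ps = hd qs"
    "last ps = last qs" "distinct ps" "set ps \<inter> F = {}" "length ps = 2 * length qs - 1"
    using interleaved_path[OF simple _ qs(2) _ assms(2) big] by blast
  have "hd qs \<in> A" "last qs \<in> A"
    using \<open>qs \<noteq> []\<close> qs(1) R' R(1) hd_in_set last_in_set by fastforce+
  then have "adj u (hd ps)" "adj (last ps) w"
    using ps(3,4) by (auto simp: A_def neighbors_def insert_commute)
  with ps len show ?thesis by blast
qed

lemma cycle_contradiction:
  assumes "distinct xs" "length xs = m" "successively adj xs" "adj (last xs) (hd xs)"
  shows False
  using cycle_of_list[OF simple assms(1,2) _ assms(3,4)] m free by simp

text \<open>The edge would close a path of length \<open>m - 1\<close> to a cycle of length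
  \<open>m\<close>.\<close>

lemma linked_not_adj:
  assumes "linked u v"
  shows "\<not> adj u v"
proof
  assume uv: "adj u v"
  obtain k where k: "m = 2 * k + 1" using m by (auto elim: oddE)
  have "card {u, v} \<le> m" using m card_length[of "[u, v]"] by simp
  then obtain ps where ps: "distinct ps" "ps \<noteq> []" "set ps \<inter> {u, v} = {}" "length ps = 2 * k - 1"
    "successively adj ps" "adj u (hd ps)" "adj (last ps) v"
    using linked_path[OF assms, of "{u, v}" k] k m by auto
  show False
    by (rule cycle_contradiction[of "u # ps @ [v]"])
      (use ps uv adj_verts[OF uv] k m in
        \<open>auto simp: successively_Cons successively_append_iff insert_commute\<close>)
qed

text \<open>The edge, a path of length 2 from \<open>u\<close> to \<open>w\<close> and a disjoint
  one of length \<open>m - 3\<close> from \<open>w\<close> to \<open>v\<close> would form a cycle of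
  length \<open>m\<close>.\<close>

lemma linked_trans_not_adj:
  assumes "linked u w" "linked w v"
  shows "\<not> adj u v"
proof
  assume uv: "adj u v"
  show False
  proof (cases "w = u \<or> w = v")
    case True
    then have "linked u v" using assms by (auto simp: linked_commute)
    with linked_not_adj uv show False by blast
  next
    case False
    obtain k where k: "m = 2 * k + 1" using m by (auto elim: oddE)
    then have k_ge: "1 \<le> k - 1" "k - 1 \<le> m" using m by auto
    have "card {u, v, w} \<le> m" using m card_length[of "[u, v, w]"] by simp
    then obtain ps where ps: "distinct ps" "ps \<noteq> []" "set ps \<inter> {u, v, w} = {}"
      "length ps = 1" "successively adj ps" "adj u (hd ps)" "adj (last ps) w"
      using linked_path[OF assms(1), of "{u, v, w}" 1] m by auto
    have "card (set ([u, v, w] @ ps)) \<le> m"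
      using m ps(4) card_length[of "[u, v, w] @ ps"] by simp
    from linked_path[OF assms(2) List.finite_set this k_ge] obtain qs where qs: "distinct qs" "qs \<noteq> []" "set qs \<inter> set ([u, v, w] @ ps) = {}"
      "length qs = 2 * (k - 1) - 1" "successively adj qs" "adj w (hd qs)" "adj (last qs) v"
      by blast
    show False
      by (rule cycle_contradiction[of "u # ps @ [w] @ qs @ [v]"])
        (use ps qs uv adj_verts[OF uv] False k m in
          \<open>auto simp: successively_Cons successively_append_iff insert_commute\<close>)
  qed
qed

text \<open>A path of length \<open>m - 3\<close> between the linked ends would close the three
  edges to a cycle of length \<open>m\<close>.\<close>

lemma no_linked_ends:
  assumes "adj w u" "adj u v" "adj v w'" "w \<noteq> w'"
  shows "\<not> linked w w'"
proof
  assume l: "linked w w'"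
  \<comment> \<open>Either coincidence would make the linked vertices \<open>w\<close> and
    \<open>w'\<close> adjacent.\<close>
  have "w \<noteq> v" "w' \<noteq> u"
    using l linked_not_adj assms by (auto simp: linked_commute insert_commute)
  then have dist: "distinct [u, v, w, w']"
    using assms adj_verts by auto
  obtain k where k: "m = 2 * k + 1" using m by (auto elim: oddE)
  then have k_ge: "1 \<le> k - 1" "k - 1 \<le> m" using m by auto
  have "card (set [u, v, w, w']) \<le> m" using m card_length[of "[u, v, w, w']"] by simp
  moreover have "linked w' w" using l by (simp add: linked_commute)
  ultimately obtain ps where ps: "distinct ps" "ps \<noteq> []" "set ps \<inter> set [u, v, w, w'] = {}"
    "length ps = 2 * (k - 1) - 1" "successively adj ps" "adj w' (hd ps)" "adj (last ps) w"
    using linked_path[OF _ List.finite_set _ k_ge] by blast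
  show False
    by (rule cycle_contradiction[of "[u, v, w'] @ ps @ [w]"])
      (use ps assms dist k m in
        \<open>auto simp: successively_Cons successively_append_iff insert_commute\<close>)
qed

section \<open>Colouring by maximal unlinked sets and by cliques of linked vertices\<close>

definition unlinked :: "'a set \<Rightarrow> bool" where
  "unlinked Y \<longleftrightarrow> (\<forall>x\<in>Y. \<forall>y\<in>Y. x \<noteq> y \<longrightarrow> \<not> linked x y)"

text \<open>Maximality makes every vertex linked to a member. There are at most \<open>p\<close>
  members by \<open>linked_pair\<close>; with fewer, choosing a linked member is a proper colouring,
  as adjacent vertices have no linked vertex in common.\<close>

lemma exists_maximal_unlinked:
  assumes "unlinked Y0" "Y0 \<subseteq> verts G" and deg: "\<And>v. v \<in> verts G \<Longrightarrow> h \<le> card (N v)"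
    and col: "\<not> colorable G (p - 1)"
  obtains Y where "Y0 \<subseteq> Y" "Y \<subseteq> verts G" "unlinked Y" "card Y = p"
    "\<And>v. v \<in> verts G \<Longrightarrow> \<exists>y\<in>Y. linked v y"
proof -
  have fin: "finite (verts G)" using simple by (simp add: simple_graph_def)
  define \<Y> where "\<Y> = {Y. Y \<subseteq> verts G \<and> unlinked Y}"
  have "finite \<Y>" using fin by (simp add: \<Y>_def)
  moreover have "Y0 \<in> \<Y>" using assms by (simp add: \<Y>_def)
  ultimately obtain Y where Y: "Y \<in> \<Y>" "Y0 \<subseteq> Y" "\<And>Z. Z \<in> \<Y> \<Longrightarrow> Y \<subseteq> Z \<Longrightarrow> Y = Z"
    using finite_has_maximal2 by metis
  have sub: "Y \<subseteq> verts G" and unl: "unlinked Y" using Y by (auto simp: \<Y>_def)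
  have dom: "\<exists>y\<in>Y. linked v y" if v: "v \<in> verts G" for v
  proof (cases "v \<in> Y")
    case True
    \<comment> \<open>A vertex is linked to itself, since its codegree with itself is its
      degree.\<close>
    then show ?thesis using deg[OF v] by (intro bexI[of _ v]) (auto simp: codegree_def)
  next
    case False
    then have "\<not> unlinked (insert v Y)"
      using Y(3)[of "insert v Y"] v sub by (auto simp: \<Y>_def)
    then show ?thesis using unl linked_commute unfolding unlinked_def by blast
  qed
  have "card Y \<le> p"
  proof (rule ccontr)
    assume "\<not> card Y \<le> p"
    then obtain Z where Z: "Z \<subseteq> Y" "card Z = Suc p"
      using obtain_subset_with_card_n[of "Suc p" Y] by auto
    with linked_pair[of Z] sub have "\<exists>x\<in>Z. \<exists>y\<in>Z. x \<noteq> y \<and> linked x y" by auto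
    with unl Z(1) show False unfolding unlinked_def by blast
  qed
  moreover have "\<not> card Y \<le> p - 1"
  proof
    assume le: "card Y \<le> p - 1"
    define f where "f v = (SOME y. y \<in> Y \<and> linked v y)" for v
    have f: "f v \<in> Y \<and> linked v (f v)" if "v \<in> verts G" for v
      using someI_ex[of "\<lambda>y. y \<in> Y \<and> linked v y"] dom[OF that] by (auto simp: f_def)
    have "colorable G (p - 1)"
    proof (rule colorableI[OF _ le _ _ simple])
      show "finite Y" using sub fin finite_subset by blast
      show "f v \<in> Y" if "v \<in> verts G" for v using f that by blast
      show "f u \<noteq> f v" if "adj u v" for u v
        using that f[of u] f[of v] adj_verts[OF that] linked_trans_not_adj linked_commute by metis
    qed
    with col show False by blast
  qed
  ultimately show ?thesis using that[OF Y(2) sub unl _ dom] by linarith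
qed

text \<open>Otherwise \<open>y1\<close> and \<open>y2\<close> can be merged into one colour: the
  only conflicts would be edges between a vertex linked to \<open>y1\<close> alone and one linked to
  \<open>y2\<close> alone.\<close>

lemma edge_between_exclusive:
  assumes Y: "Y \<subseteq> verts G" "card Y = p"
    and dom: "\<And>v. v \<in> verts G \<Longrightarrow> \<exists>y\<in>Y. linked v y"
    and y: "y1 \<in> Y" "y2 \<in> Y" "y1 \<noteq> y2" and col: "\<not> colorable G (p - 1)"
  obtains u v where "adj u v" "\<And>z. z \<in> Y - {y1} \<Longrightarrow> \<not> linked u z"
    "\<And>z. z \<in> Y - {y2} \<Longrightarrow> \<not> linked v z"
proof (rule ccontr)
  assume "\<not> thesis"
  with that have no: "\<exists>z\<in>Y. z \<noteq> y1 \<and> linked u z \<or> z \<noteq> y2 \<and> linked v z" if "adj u v" for u v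
    using \<open>adj u v\<close> by (metis Diff_iff singletonI)
  have finY: "finite Y"
    using Y simple finite_subset unfolding simple_graph_def by blast
  define J where "J v = {y \<in> Y. linked v y}" for v
  have J: "J v \<noteq> {}" if "v \<in> verts G" for v using dom[OF that] by (auto simp: J_def)
  have disj: "J u \<inter> J v = {}" if "adj u v" for u v
    using linked_trans_not_adj[of u _ v] that linked_commute by (auto simp: J_def)
  \<comment> \<open>A third colour is preferred; \<open>y1\<close> stands for the merged pair and is
    used only where no third colour is available.\<close>
  define f where "f v = (if J v \<subseteq> {y1, y2} then y1 else SOME y. y \<in> J v - {y1, y2})" for v
  have f: "f v \<in> J v - {y1, y2}" if "\<not> J v \<subseteq> {y1, y2}" for v
  proof -
    have "\<exists>y. y \<in> J v - {y1, y2}" using that by blast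
    then have "(SOME y. y \<in> J v - {y1, y2}) \<in> J v - {y1, y2}" by (rule someI_ex)
    then show ?thesis using that by (simp only: f_def if_False)
  qed
  have "colorable G (p - 1)"
  proof (rule colorableI[of "Y - {y2}" _ _ f, OF _ _ _ _ simple])
    show "card (Y - {y2}) \<le> p - 1" using y Y finY by simp
    show "f v \<in> Y - {y2}" for v
      using f[of v] y by (cases "J v \<subseteq> {y1, y2}") (auto simp: f_def J_def)
    show "f u \<noteq> f v" if uv: "adj u v" for u v
    proof (cases "J u \<subseteq> {y1, y2}")
      case True
      show ?thesis
      proof (cases "J v \<subseteq> {y1, y2}")
        case v: True
        have "J u = {y1} \<and> J v = {y2} \<or> J u = {y2} \<and> J v = {y1}"
        proof -
          obtain a b where ab: "a \<in> J u" "b \<in> J v"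
            using J[of u] J[of v] adj_verts[OF uv] by auto
          with disj[OF uv] have "a \<noteq> b" "a \<notin> J v" "b \<notin> J u" by auto
          with ab True v show ?thesis by auto
        qed
        moreover have "adj v u" using uv by (simp add: insert_commute)
        ultimately show ?thesis
          using no[OF uv] no[of v u] unfolding J_def by blast
      next
        case False
        with True f[OF False] show ?thesis by (auto simp: f_def)
      qed
    next
      case False
      then have u: "f u \<in> J u - {y1, y2}" by (rule f)
      show ?thesis
      proof (cases "J v \<subseteq> {y1, y2}")
        case True
        then have "f v = y1" by (simp add: f_def)
        with u show ?thesis by auto
      next
        case False
        from u f[OF False] disj[OF uv] show ?thesis by auto
      qed
    qed
  qed (use finY in simp)
  with col show False by blast
qed

text \<open>Without such a colouring, the vertices with all but few neighbours in a single clique induce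
  a fixed-point-free involution on the cliques.\<close>

lemma no_odd_clique_partition:
  assumes C: "finite C" "card C = p" "odd p"
    and c: "\<And>v. v \<in> verts G \<Longrightarrow> c v \<in> C"
    and clique: "\<And>u v. u \<in> verts G \<Longrightarrow> v \<in> verts G \<Longrightarrow> c u = c v \<Longrightarrow> linked u v"
    and deg: "\<And>v. v \<in> verts G \<Longrightarrow> h \<le> card (N v)"
  shows "colorable G (p - 1)"
proof (rule ccontr)
  assume col: "\<not> colorable G (p - 1)"
  \<comment> \<open>Two neighbours are required so that one of them avoids a given vertex. In a
    clique outside \<open>J z\<close> the vertex \<open>z\<close> has at most one neighbour.\<close>
  define J where "J z = {i \<in> C. \<exists>a\<in>N z. \<exists>b\<in>N z. a \<noteq> b \<and> c a = i \<and> c b = i}" for z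
  have N_verts: "a \<in> verts G" if "a \<in> N z" for a z
    using that neighbors_subset[OF simple] by blast
  have disj: "J u \<inter> J v = {}" if uv: "adj u v" for u v
  proof (rule ccontr)
    assume "J u \<inter> J v \<noteq> {}"
    then obtain i a b b' where i: "a \<in> N u" "c a = i" "b \<in> N v" "b' \<in> N v" "b \<noteq> b'" "c b = i" "c b' = i"
      unfolding J_def by blast
    obtain w where w: "w \<in> N v" "w \<noteq> a" "c w = i" using i by metis
    \<comment> \<open>The path \<open>a\<close>, \<open>u\<close>, \<open>v\<close>,
      \<open>w\<close> would have both ends in clique \<open>i\<close>.\<close>
    have "\<not> linked a w"
      by (rule no_linked_ends[of a u v w])
        (use i w uv in \<open>auto simp: neighbors_def insert_commute\<close>)
    with clique[of a w] i w N_verts show False by auto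
  qed
  have inj_bound: "card A \<le> p" if "A \<subseteq> verts G" "inj_on c A" for A
    using card_inj_on_le[OF that(2) _ C(1)] that(1) c C(2) by blast
  have few: "a = b" if "i \<in> C" "i \<notin> J z" "a \<in> N z" "b \<in> N z" "c a = i" "c b = i" for a b i z
    using that unfolding J_def by blast
  have J_nonempty: "J z \<noteq> {}" if z: "z \<in> verts G" for z
  proof
    assume "J z = {}"
    then have "inj_on c (N z)"
      using few[of _ z] c N_verts unfolding inj_on_def by (metis empty_iff)
    then have "card (N z) \<le> p" using N_verts by (intro inj_bound) auto
    with deg[OF z] h show False by simp
  qed
  \<comment> \<open>Otherwise every vertex could choose a colour from \<open>J z\<close> other than
    \<open>i\<close>, which saves a colour.\<close>
  have "\<exists>z\<in>verts G. J z = {i}" if i: "i \<in> C" for i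
  proof (rule ccontr)
    assume "\<not> ?thesis"
    then have ex: "\<exists>j. j \<in> J z - {i}" if "z \<in> verts G" for z
      using J_nonempty[OF that] that by blast
    define f where "f z = (SOME j. j \<in> J z - {i})" for z
    have f: "f z \<in> J z - {i}" if "z \<in> verts G" for z
      unfolding f_def by (rule someI_ex[OF ex[OF that]])
    have "colorable G (p - 1)"
    proof (rule colorableI[of "C - {i}" _ _ f, OF _ _ _ _ simple])
      show "f v \<in> C - {i}" if "v \<in> verts G" for v
        using f[OF that] by (auto simp: J_def)
      show "f u \<noteq> f v" if "adj u v" for u v
        using f[of u] f[of v] disj[OF that] adj_verts[OF that] by auto
    qed (use C i in auto)
    with col show False by blast
  qed
  then obtain z where z: "\<And>i. i \<in> C \<Longrightarrow> z i \<in> verts G" "\<And>i. i \<in> C \<Longrightarrow> J (z i) = {i}"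
    by metis
  have inj_off: "inj_on c {a \<in> N (z i). c a \<noteq> i}" if i: "i \<in> C" for i
  proof (rule inj_onI)
    fix a b assume ab: "a \<in> {a \<in> N (z i). c a \<noteq> i}" "b \<in> {a \<in> N (z i). c a \<noteq> i}" "c a = c b"
    then have "c a \<in> C" "c a \<notin> J (z i)" using c N_verts z(2)[OF i] by auto
    with ab show "a = b" by (intro few[of "c a" "z i" a b]) simp_all
  qed
  \<comment> \<open>Representatives in the same clique are linked, yet their common neighbours lie
    at most one in each clique, so there are at most \<open>p < h\<close> of them.\<close>
  have "inj_on (\<lambda>i. c (z i)) C"
  proof (rule inj_onI, rule ccontr)
    fix i j assume ij: "i \<in> C" "j \<in> C" "c (z i) = c (z j)" "i \<noteq> j"
    have "inj_on c (N (z i) \<inter> N (z j))"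
    proof (rule inj_onI)
      fix a b assume ab: "a \<in> N (z i) \<inter> N (z j)" "b \<in> N (z i) \<inter> N (z j)" "c a = c b"
      have "c a \<noteq> i \<or> c a \<noteq> j" using ij by blast
      with ab show "a = b"
        using inj_onD[OF inj_off[OF ij(1)], of a b] inj_onD[OF inj_off[OF ij(2)], of a b] by auto
    qed
    then have "codegree G (z i) (z j) \<le> p"
      unfolding codegree_def using N_verts by (intro inj_bound) auto
    moreover have "linked (z i) (z j)" using ij z by (intro clique) auto
    ultimately show False using h by simp
  qed
  then have surj: "(\<lambda>i. c (z i)) ` C = C"
    using C(1) c z(1) by (intro endo_inj_surj) auto
  \<comment> \<open>The representative \<open>z (\<tau> q)\<close> lies in clique \<open>q\<close>
    and sends all but few of its edges to clique \<open>\<tau> q\<close>.\<close>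
  define \<tau> where "\<tau> = inv_into C (\<lambda>i. c (z i))"
  have \<tau>: "\<tau> q \<in> C" "c (z (\<tau> q)) = q" if "q \<in> C" for q
    using that surj inv_into_into[of q "\<lambda>i. c (z i)" C] f_inv_into_f[of q "\<lambda>i. c (z i)" C]
    by (auto simp: \<tau>_def)
  \<comment> \<open>All vertices of a clique inherit this direction: \<open>b\<close> is linked to
    the representative in its clique, and without two neighbours in clique
    \<open>\<tau> (c b)\<close> the two would have at most \<open>p\<close> common
    neighbours.\<close>
  have \<tau>_J: "\<tau> (c b) \<in> J b" if b: "b \<in> verts G" for b
  proof (rule ccontr)
    define i where "i = \<tau> (c b)"
    assume "\<tau> (c b) \<notin> J b"
    then have "i \<notin> J b" by (simp add: i_def)
    have i: "i \<in> C" "c (z i) = c b" using \<tau> c[OF b] by (auto simp: i_def)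
    have "inj_on c (N b \<inter> N (z i))"
    proof (rule inj_onI)
      fix x y assume xy: "x \<in> N b \<inter> N (z i)" "y \<in> N b \<inter> N (z i)" "c x = c y"
      show "x = y"
      proof (cases "c x = i")
        case True
        with xy show ?thesis by (intro few[OF i(1) \<open>i \<notin> J b\<close>, of x y]) simp_all
      next
        case False
        with xy show ?thesis using inj_onD[OF inj_off[OF i(1)], of x y] by auto
      qed
    qed
    then have "codegree G b (z i) \<le> p"
      unfolding codegree_def using N_verts by (intro inj_bound) auto
    moreover have "linked b (z i)" using b i z by (intro clique) auto
    ultimately show False using h by simp
  qed
  have no_inner: "c u \<noteq> c v" if "adj u v" for u v
    using clique[of u v] linked_not_adj[of u v] that adj_verts[OF that] by blast
  have "even (card C)"
  proof (rule even_card_involution[OF C(1)])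
    fix q assume q: "q \<in> C"
    \<comment> \<open>A fixed point would give an edge between two vertices of one clique, which are
      linked.\<close>
    have fixfree: "\<tau> q \<noteq> q" if q: "q \<in> C" for q
    proof
      assume eq: "\<tau> q = q"
      have "z (\<tau> q) \<in> verts G" using \<tau> q z by blast
      from \<tau>_J[OF this] obtain a where "a \<in> N (z (\<tau> q))" "c a = q"
        using \<tau>(2)[OF q] eq by (auto simp: J_def)
      with no_inner[of "z (\<tau> q)" a] \<tau>(2)[OF q] show False by (auto simp: neighbors_def)
    qed
    moreover have "\<tau> (\<tau> q) = q"
    proof (rule ccontr)
      define q' where "q' = \<tau> q"
      define q'' where "q'' = \<tau> q'"
      assume "\<tau> (\<tau> q) \<noteq> q"
      then have neq: "q'' \<noteq> q" by (simp add: q''_def q'_def)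
      have q''C: "q'' \<in> C" using \<tau> q by (simp add: q''_def q'_def)
      \<comment> \<open>Without an edge between them, cliques \<open>q\<close> and
        \<open>q''\<close> could share a colour.\<close>
      have "\<exists>u v. adj u v \<and> c u = q \<and> c v = q''"
      proof (rule ccontr)
        assume none: "\<not> ?thesis"
        have "colorable G (p - 1)"
        proof (rule colorableI[of "C - {q''}" _ _ "\<lambda>v. if c v = q'' then q else c v", OF _ _ _ _ simple])
          show "(if c v = q'' then q else c v) \<in> C - {q''}" if "v \<in> verts G" for v
            using c[OF that] q neq by auto
          show "(if c u = q'' then q else c u) \<noteq> (if c v = q'' then q else c v)" if uv: "adj u v" for u v
          proof -
            have "adj v u" using uv by (simp add: insert_commute)
            with none uv no_inner[OF uv] show ?thesis by (auto split: if_splits)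
          qed
        qed (use C q''C in auto)
        with col show False by blast
      qed
      then obtain u v where uv: "adj u v" "c u = q" "c v = q''" by blast
      have "q' \<in> J u" using \<tau>_J[of u] uv adj_verts by (auto simp: q'_def)
      then obtain b where b: "b \<in> N u" "c b = q'" by (auto simp: J_def)
      have "q'' \<in> J b" using \<tau>_J[of b] b N_verts by (auto simp: q''_def)
      then obtain y where y: "y \<in> N b" "c y = q''" "y \<noteq> v"
        unfolding J_def by (smt (verit) mem_Collect_eq)
      \<comment> \<open>The second neighbour of \<open>b\<close> in clique \<open>q''\<close> makes
        \<open>v\<close>, \<open>u\<close>, \<open>b\<close>, \<open>y\<close> a path with both ends
        in that clique.\<close>
      have "\<not> linked v y"
        by (rule no_linked_ends[of v u b y])
          (use uv b y in \<open>auto simp: neighbors_def insert_commute\<close>)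
      moreover have "linked v y" using uv y N_verts adj_verts by (intro clique) auto
      ultimately show False by blast
    qed
    ultimately show "\<tau> q \<in> C \<and> \<tau> q \<noteq> q \<and> \<tau> (\<tau> q) = q" using \<tau> q by blast
  qed
  with C show False by simp
qed

text \<open>Codegree at least \<open>g\<close> with a common vertex \<open>x\<close> implies being
  linked: an unlinked pair extends to a maximal unlinked set, and \<open>close\<close> would link
  \<open>x\<close> to both ends of the edge exclusive to the pair. So by \<open>cover\<close> the
  members of one unlinked set of size \<open>p\<close> sort the vertices into cliques, and
  \<open>p\<close> is odd.\<close>

lemma colorable_if_close:
  fixes g :: nat
  assumes "odd p" "p \<ge> 2" and deg: "\<And>v. v \<in> verts G \<Longrightarrow> h \<le> card (N v)"
    and cover: "\<And>Y v. Y \<subseteq> verts G \<Longrightarrow> card Y = p \<Longrightarrow> unlinked Y \<Longrightarrow> v \<in> verts G \<Longrightarrow>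
      \<exists>y\<in>Y. g \<le> codegree G v y"
    and close: "\<And>Y y u x. Y \<subseteq> verts G \<Longrightarrow> card Y = p \<Longrightarrow> unlinked Y \<Longrightarrow> y \<in> Y \<Longrightarrow> u \<in> verts G \<Longrightarrow>
      (\<And>z. z \<in> Y - {y} \<Longrightarrow> \<not> linked u z) \<Longrightarrow> g \<le> codegree G x y \<Longrightarrow> linked x u"
  shows "colorable G (p - 1)"
proof (rule ccontr)
  assume col: "\<not> colorable G (p - 1)"
  have trans: "linked v v'"
    if v: "v \<in> verts G" "v' \<in> verts G" "g \<le> codegree G v x" "g \<le> codegree G v' x" for v v' x
  proof (rule ccontr)
    assume un: "\<not> linked v v'"
    then have "v \<noteq> v'" using deg[OF v(1)] by (auto simp: codegree_def)
    have "unlinked {v, v'}" using un linked_commute by (auto simp: unlinked_def)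
    then obtain Y where Y: "{v, v'} \<subseteq> Y" "Y \<subseteq> verts G" "unlinked Y" "card Y = p"
      "\<And>w. w \<in> verts G \<Longrightarrow> \<exists>y\<in>Y. linked w y"
      using exists_maximal_unlinked[OF _ _ deg col, of "{v, v'}"] v by auto
    obtain u u' where u: "adj u u'" "\<And>z. z \<in> Y - {v} \<Longrightarrow> \<not> linked u z"
      "\<And>z. z \<in> Y - {v'} \<Longrightarrow> \<not> linked u' z"
      using edge_between_exclusive[OF Y(2,4,5) _ _ \<open>v \<noteq> v'\<close> col] Y(1) by auto
    have "linked x u" "linked x u'"
      using close[OF Y(2,4,3), of v u x] close[OF Y(2,4,3), of v' u' x] Y(1) v u adj_verts[OF u(1)]
      by (auto simp: codegree_commute)
    with linked_trans_not_adj[of u x u'] u(1) show False by (simp add: codegree_commute)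
  qed
  obtain Y where Y: "Y \<subseteq> verts G" "unlinked Y" "card Y = p"
    using exists_maximal_unlinked[OF _ _ deg col, of "{}"] by (auto simp: unlinked_def)
  define c where "c v = (SOME y. y \<in> Y \<and> g \<le> codegree G v y)" for v
  have c: "c v \<in> Y \<and> g \<le> codegree G v (c v)" if "v \<in> verts G" for v
    unfolding c_def by (rule someI_ex) (use cover[OF Y(1,3,2) that] in blast)
  have "finite Y" using Y(1) simple finite_subset unfolding simple_graph_def by blast
  then have "colorable G (p - 1)"
  proof (rule no_odd_clique_partition[OF _ Y(3) assms(1) _ _ deg])
    show "c v \<in> Y" if "v \<in> verts G" for v using c that by blast
    show "linked u v" if "u \<in> verts G" "v \<in> verts G" "c u = c v" for u v
      using trans[OF that(1,2), of "c u"] c[OF that(1)] c[OF that(2)] that(3) by simp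
  qed
  with col show False by blast
qed

end

section \<open>Counting neighbourhoods and the resulting degree threshold\<close>

lemma card_neighbors_union:
  assumes "simple_graph G" "finite Y"
  shows "card (neighbors G x) + card (\<Union>y\<in>Y. neighbors G y)
    \<le> card (neighbors G x \<union> (\<Union>y\<in>Y. neighbors G y)) + (\<Sum>y\<in>Y. codegree G x y)"
proof -
  have "card (neighbors G x \<inter> (\<Union>y\<in>Y. neighbors G y)) \<le> (\<Sum>y\<in>Y. codegree G x y)"
    using card_UN_le[OF assms(2), of "\<lambda>y. neighbors G x \<inter> neighbors G y"]
    by (simp add: codegree_def)
  moreover have "card (neighbors G x) + card (\<Union>y\<in>Y. neighbors G y)
    = card (neighbors G x \<union> (\<Union>y\<in>Y. neighbors G y)) + card (neighbors G x \<inter> (\<Union>y\<in>Y. neighbors G y))"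
    using assms finite_neighbors by (intro card_Un_Int) auto
  ultimately show ?thesis by linarith
qed

text \<open>The neighbourhoods are almost disjoint; the error term is a crude count of pairs, each
  costing at most \<open>h\<close>.\<close>

lemma sum_degrees_unlinked:
  assumes "simple_graph G" "finite Y"
    and "\<And>x y. x \<in> Y \<Longrightarrow> y \<in> Y \<Longrightarrow> x \<noteq> y \<Longrightarrow> codegree G x y \<le> h"
  shows "(\<Sum>y\<in>Y. card (neighbors G y)) \<le> card (\<Union>y\<in>Y. neighbors G y) + card Y * card Y * h"
  using assms(2,3)
proof induction
  case (insert x Y)
  have "(\<Sum>y\<in>Y. codegree G x y) \<le> (\<Sum>y\<in>Y. h)"
    using insert by (intro sum_mono) auto
  then have "(\<Sum>y\<in>Y. codegree G x y) \<le> card Y * h" by simp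
  moreover have "(\<Sum>y\<in>Y. card (neighbors G y)) \<le> card (\<Union>y\<in>Y. neighbors G y) + card Y * card Y * h"
    using insert by (intro insert.IH) auto
  ultimately show ?case
    using card_neighbors_union[OF assms(1) insert(1), of x] insert(1,2) by (simp add: algebra_simps)
qed simp

text \<open>Used for both hypotheses of \<open>colorable_if_close\<close>: almost disjoint
  neighbourhoods leave little room outside them, so \<open>v\<close> shares many neighbours with the
  members of \<open>Y\<close>.\<close>

lemma sum_degrees_bound:
  assumes "simple_graph G" "finite Y"
    and "\<And>x y. x \<in> Y \<Longrightarrow> y \<in> Y \<Longrightarrow> x \<noteq> y \<Longrightarrow> codegree G x y \<le> h"
  shows "card (neighbors G v) + (\<Sum>y\<in>Y. card (neighbors G y))
    \<le> card (verts G) + card Y * card Y * h + (\<Sum>y\<in>Y. codegree G v y)"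
proof -
  have "card (neighbors G v \<union> (\<Union>y\<in>Y. neighbors G y)) \<le> card (verts G)"
    using assms(1) neighbors_subset[OF assms(1)]
    by (intro card_mono) (auto simp: simple_graph_def)
  with card_neighbors_union[OF assms(1,2), of v] sum_degrees_unlinked[OF assms]
  show ?thesis by linarith
qed

text \<open>\<open>main\<close> says that the degree density exceeds
  \<open>(p + 1) / (p * p + p + 1)\<close> by an error of order \<open>h\<close>. There is then no
  room for \<open>p + 1\<close> pairwise unlinked vertices, and \<open>cover\<close> and
  \<open>close\<close> follow by counting.\<close>

lemma colorable_if_min_degree:
  fixes G :: "'a graph" and n \<delta> m p h r :: nat
  assumes simple: "simple_graph G" and free: "free_of {cycle_graph m} G" and m: "odd m" "m \<ge> 5"
    and p: "odd p" "p \<ge> 2"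
    and ramsey: "\<And>V :: 'a set. \<And>E. finite V \<Longrightarrow> card V \<ge> r \<Longrightarrow>
      \<exists>R \<subseteq> V. card R = m \<and> clique R E \<or> card R = Suc p \<and> indep R E"
    and h: "h \<ge> r + 4 * m + 2 * p + 5" and n: "n = card (verts G)"
    and deg: "\<And>v. v \<in> verts G \<Longrightarrow> \<delta> \<le> card (neighbors G v)"
    and main: "(p + 1) * n + 2 * (p * p + p + 1) * (p * p + p + 1) * h < (p * p + p + 1) * \<delta>"
  shows "colorable G (p - 1)"
proof -
  define P where "P = p * p + p + 1"
  have main': "(p + 1) * n + 2 * P * P * h < P * \<delta>" using main by (simp add: P_def)
  have \<delta>h: "2 * P * h < \<delta>"
  proof (rule ccontr)
    assume "\<not> ?thesis"
    then have "P * \<delta> \<le> P * (2 * P * h)" by (intro mult_left_mono) auto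
    with main' show False by (simp add: algebra_simps)
  qed
  have Pp: "p * p \<le> P" "1 \<le> P" "p \<le> P" by (simp_all add: P_def)
  have codegree_le: "codegree G x y \<le> card (neighbors G y)" for x y
    unfolding codegree_def using finite_neighbors[OF simple] by (intro card_mono) auto
  have finite: "finite Y" if "Y \<subseteq> verts G" for Y
    using that simple finite_subset unfolding simple_graph_def by blast
  have sum_deg: "card Y * \<delta> \<le> (\<Sum>y\<in>Y. card (neighbors G y))" if "Y \<subseteq> verts G" for Y
    using sum_bounded_below[of Y \<delta> "\<lambda>y. card (neighbors G y)"] deg that by auto
  interpret odd_cycle_free_graph G m p h r
  proof
    fix Y assume Y: "Y \<subseteq> verts G" "card Y = Suc p"
    show "\<exists>x\<in>Y. \<exists>y\<in>Y. x \<noteq> y \<and> h \<le> codegree G x y"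
    proof (rule ccontr)
      assume "\<not> ?thesis"
      then have "codegree G x y \<le> h" if "x \<in> Y" "y \<in> Y" "x \<noteq> y" for x y
        using that nat_le_linear by blast
      then have "(\<Sum>y\<in>Y. card (neighbors G y))
          \<le> card (\<Union>y\<in>Y. neighbors G y) + Suc p * Suc p * h"
        using sum_degrees_unlinked[OF simple finite[OF Y(1)], of h] Y(2) by auto
      moreover have "card (\<Union>y\<in>Y. neighbors G y) \<le> n"
        unfolding n using neighbors_subset[OF simple] simple
        by (intro card_mono) (auto simp: simple_graph_def)
      ultimately have "Suc p * \<delta> \<le> n + Suc p * Suc p * h"
        using sum_deg[OF Y(1)] Y(2) by simp
      then have "P * (Suc p * \<delta>) \<le> P * (n + Suc p * Suc p * h)" by (rule mult_left_mono) simp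
      moreover have "Suc p * ((p + 1) * n + 2 * P * P * h) < Suc p * (P * \<delta>)"
        using main' by (intro mult_strict_left_mono) auto
      moreover have "P * n \<le> Suc p * ((p + 1) * n)"
        by (simp add: P_def algebra_simps)
      moreover have "P * (Suc p * Suc p * h) \<le> Suc p * (2 * P * P * h)"
      proof -
        have "Suc p \<le> 2 * P" by (simp add: P_def)
        then have "(P * Suc p * h) * Suc p \<le> (P * Suc p * h) * (2 * P)" by (rule mult_left_mono) simp
        then show ?thesis by (simp only: ac_simps)
      qed
      moreover have "Suc p * (P * \<delta>) = P * (Suc p * \<delta>)" by (simp only: ac_simps)
      ultimately show False unfolding distrib_left by linarith
    qed
  qed (use assms in auto)
  \<comment> \<open>About \<open>n - p * \<delta>\<close> vertices lie outside \<open>p\<close>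
    unlinked neighbourhoods. A vertex \<open>u\<close> linked to no member except perhaps
    \<open>y\<close> therefore misses at most \<open>g - h\<close> neighbours of \<open>y\<close>,
    so codegree \<open>g\<close> with \<open>y\<close> forces \<open>h\<close> common neighbours
    with \<open>u\<close>.\<close>
  define g where "g = n + P * h - p * \<delta>"
  have unlinked_le: "codegree G x y \<le> h" if "unlinked Y" "x \<in> Y" "y \<in> Y" "x \<noteq> y" for x y Y
    using that nat_le_linear unfolding unlinked_def by blast
  show ?thesis
  proof (rule colorable_if_close[OF p])
    show "h \<le> card (neighbors G v)" if "v \<in> verts G" for v
    proof -
      have "h \<le> 2 * P * h" using Pp(2) by simp
      with \<delta>h deg[OF that] show ?thesis by linarith
    qed
  next
    fix Y v assume Y: "Y \<subseteq> verts G" "card Y = p" "unlinked Y" and v: "v \<in> verts G"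
    show "\<exists>y\<in>Y. g \<le> codegree G v y"
    proof (rule ccontr)
      assume "\<not> ?thesis"
      then have "(\<Sum>y\<in>Y. codegree G v y) \<le> (\<Sum>y\<in>Y. g)"
        by (intro sum_mono) auto
      then have "(\<Sum>y\<in>Y. codegree G v y) \<le> p * g" using Y(2) by simp
      moreover have "card (neighbors G v) + (\<Sum>y\<in>Y. card (neighbors G y))
          \<le> n + p * p * h + (\<Sum>y\<in>Y. codegree G v y)"
        using sum_degrees_bound[OF simple finite[OF Y(1)] unlinked_le[OF Y(3)], of v] Y(2) n
        by simp
      ultimately have le: "\<delta> + p * \<delta> \<le> n + p * p * h + p * g"
        using deg[OF v] sum_deg[OF Y(1)] Y(2) by simp
      have pph: "p * p * h \<le> P * h" using Pp(1) by simp
      show False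
      proof (cases "n + P * h \<le> p * \<delta>")
        case True
        \<comment> \<open>Here the subtraction in \<open>g\<close> truncates, and \<open>le\<close>
          would force \<open>\<delta> = 0\<close>.\<close>
        then have "g = 0" by (simp add: g_def)
        with le pph True \<delta>h show False by simp
      next
        case False
        then have "g + p * \<delta> = n + P * h" by (simp add: g_def)
        then have "p * (g + p * \<delta>) = p * (n + P * h)" by simp
        then have "p * g + p * p * \<delta> = p * n + p * P * h"
          by (simp add: distrib_left mult.assoc)
        \<comment> \<open>The threshold arises here: inserting \<open>g\<close>, about
          \<open>n - p * \<delta>\<close>, into \<open>(p + 1) * \<delta> \<le> n + p * g\<close>
          gives density at most \<open>(p + 1) / P\<close>, up to errors.\<close>
        with le have "P * \<delta> \<le> (p + 1) * n + (p * p * h + p * P * h)"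
          by (simp add: P_def algebra_simps)
        moreover have "p * p * h + p * P * h \<le> 2 * P * P * h"
        proof -
          have "p * p \<le> P * P" "p * P \<le> P * P" using Pp by (intro mult_mono; simp)+
          then have "p * p + p * P \<le> 2 * P * P" by linarith
          then have "(p * p + p * P) * h \<le> (2 * P * P) * h" by (rule mult_right_mono) simp
          then show ?thesis by (simp add: distrib_right)
        qed
        ultimately show False using main' by linarith
      qed
    qed
  next
    fix Y y u x
    assume Y: "Y \<subseteq> verts G" "card Y = p" "unlinked Y" and y: "y \<in> Y" and u: "u \<in> verts G"
      and un: "\<And>z. z \<in> Y - {y} \<Longrightarrow> \<not> h \<le> codegree G u z" and g: "g \<le> codegree G x y"
    have split: "sum f Y = f y + sum f (Y - {y})" for f :: "'a \<Rightarrow> nat"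
      using finite[OF Y(1)] y by (rule sum.remove)
    have card: "card (Y - {y}) = p - 1" using finite[OF Y(1)] y Y(2) by simp
    have "(\<Sum>z\<in>Y - {y}. codegree G u z) \<le> (\<Sum>z\<in>Y - {y}. h)"
      using un by (intro sum_mono) (meson nat_le_linear)
    then have "(\<Sum>z\<in>Y. codegree G u z) \<le> codegree G u y + (p - 1) * h"
      using split[of "codegree G u"] card by simp
    moreover have "(p - 1) * \<delta> \<le> (\<Sum>z\<in>Y - {y}. card (neighbors G z))"
      using sum_deg[of "Y - {y}"] Y(1) card by auto
    moreover have "card (neighbors G u) + (\<Sum>y\<in>Y. card (neighbors G y))
        \<le> n + p * p * h + (\<Sum>y\<in>Y. codegree G u y)"
      using sum_degrees_bound[OF simple finite[OF Y(1)] unlinked_le[OF Y(3)], of u] Y(2) n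
      by simp
    ultimately have "\<delta> + card (neighbors G y) + (p - 1) * \<delta>
        \<le> n + p * p * h + codegree G u y + (p - 1) * h"
      using deg[OF u] split[of "\<lambda>y. card (neighbors G y)"] by linarith
    moreover have "\<delta> + (p - 1) * \<delta> = p * \<delta>" "h + (p - 1) * h = p * h"
      using p(2) by (auto simp: algebra_simps simp flip: add_mult_distrib mult_Suc)
    ultimately have "card (neighbors G y) + h + p * \<delta> \<le> n + P * h + codegree G u y"
      by (simp add: P_def algebra_simps)
    with codegree_le[of u y] have "card (neighbors G y) + h \<le> g + codegree G u y"
      unfolding g_def by linarith
    moreover have "codegree G x y + codegree G u y \<le> codegree G x u + card (neighbors G y)"
    proof -
      let ?A = "neighbors G x \<inter> neighbors G y" and ?B = "neighbors G u \<inter> neighbors G y"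
      have fin: "finite ?A" "finite ?B" using finite_neighbors[OF simple] by auto
      have "card ?A + card ?B = card (?A \<union> ?B) + card (?A \<inter> ?B)"
        by (rule card_Un_Int[OF fin])
      also have "\<dots> \<le> card (neighbors G y) + card (neighbors G x \<inter> neighbors G u)"
        using finite_neighbors[OF simple] by (intro add_mono card_mono) auto
      finally show ?thesis by (simp add: codegree_def)
    qed
    ultimately show "h \<le> codegree G x u" using g by linarith
  qed
qed

text \<open>With \<open>h\<close> a small multiple of the order, all constants are below
  \<open>h\<close> for large graphs while the error stays below the surplus from
  \<open>\<epsilon>\<close>.\<close>

lemma dense_odd_cycle_free_colorable:
  assumes m: "odd m" "m \<ge> 5" and p: "odd p" "p \<ge> 2" and \<epsilon>: "\<epsilon> > (0 :: real)"
  shows "\<exists>n0. \<forall>G :: 'a graph. simple_graph G \<and> card (verts G) \<ge> n0 \<and> free_of {cycle_graph m} G \<and>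
    real (min_degree G) \<ge> ((real p + 1) / (real p ^ 2 + real p + 1) + \<epsilon>) * real (card (verts G))
    \<longrightarrow> colorable G (p - 1)"
proof -
  obtain r where r: "\<And>V :: 'a set. \<And>E. finite V \<Longrightarrow> card V \<ge> r \<Longrightarrow>
      \<exists>R \<subseteq> V. card R = m \<and> clique R E \<or> card R = Suc p \<and> indep R E"
    using ramsey2[of m "Suc p"] by metis
  define P where "P = real p ^ 2 + real p + 1"
  have P: "P \<ge> 1" by (simp add: P_def)
  define K where "K = r + 4 * m + 2 * p + 5"
  \<comment> \<open>Chosen so that the error \<open>2 * P * P * h\<close> is at most half of
    \<open>P * \<epsilon> * n\<close>.\<close>
  define \<eta> where "\<eta> = \<epsilon> / (2 * P) / 2"
  have \<eta>: "\<eta> > 0" "2 * P * (2 * \<eta>) = \<epsilon>" using \<epsilon> P by (simp_all add: \<eta>_def)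
  define n0 where "n0 = Suc (nat \<lceil>(real K + 1) / \<eta>\<rceil>)"
  show ?thesis
  proof (intro exI[of _ n0] allI impI, elim conjE)
    fix G :: "'a graph"
    assume G: "simple_graph G" "n0 \<le> card (verts G)" "free_of {cycle_graph m} G"
      and md: "((real p + 1) / (real p ^ 2 + real p + 1) + \<epsilon>) * real (card (verts G))
        \<le> real (min_degree G)"
    define n where "n = card (verts G)"
    define h where "h = nat \<lfloor>\<eta> * n\<rfloor>"
    have "(real K + 1) / \<eta> \<le> n" "n > 0"
      using G(2) unfolding n_def n0_def by linarith+
    then have "real K + 1 \<le> \<eta> * n" using \<eta> by (simp add: field_simps)
    then have h: "K \<le> h" "real h \<le> \<eta> * n" unfolding h_def by linarith+
    have "colorable G (p - 1)"
    proof (rule colorable_if_min_degree[OF G(1,3) m p r _ n_def])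
      show "r + 4 * m + 2 * p + 5 \<le> h" using h by (simp add: K_def)
      show "min_degree G \<le> card (neighbors G v)" if "v \<in> verts G" for v
        using that G(1) unfolding min_degree_def degree_eq_card_neighbors[OF G(1), symmetric]
        by (intro Min_le) (auto simp: simple_graph_def)
      have "(real p + 1) * n + 2 * P * P * h \<le> (real p + 1) * n + 2 * P * P * (\<eta> * n)"
        using h P by (intro add_left_mono mult_left_mono) auto
      also have "\<dots> = (real p + 1) * n + P * (2 * P * (2 * \<eta>)) / 2 * n"
        by simp
      also have "\<dots> < (real p + 1) * n + P * \<epsilon> * n"
        using \<open>n > 0\<close> P \<epsilon> by (simp add: \<eta>(2))
      also have "\<dots> = P * (((real p + 1) / P + \<epsilon>) * n)"
        using P by (simp add: field_simps)
      also have "\<dots> \<le> P * min_degree G"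
        using md P by (intro mult_left_mono) (auto simp: P_def n_def)
      finally have "real ((p + 1) * n + 2 * (p * p + p + 1) * (p * p + p + 1) * h)
          < real ((p * p + p + 1) * min_degree G)"
        by (simp add: P_def power2_eq_square algebra_simps)
      then show "(p + 1) * n + 2 * (p * p + p + 1) * (p * p + p + 1) * h
          < (p * p + p + 1) * min_degree G"
        by (simp only: of_nat_less_iff)
    qed
    then show "colorable G (p - 1)" .
  qed
qed

subsection \<open>Chains modulo two\<close>

declare add_bit_eq_xor [simp del] bit_not_zero_iff [simp del] bit_not_one_iff [simp del]

lemma bit_add_self [simp]: "a + a = (0 :: bit)"
  by (cases a) simp_all

lemma bit_add_self_left [simp]: "a + (a + b) = (b :: bit)"
  by (simp flip: add.assoc)

lemma sum_list_map_concat: "sum_list (map f (concat xss)) = (\<Sum>xs\<leftarrow>xss. sum_list (map f xs))"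
  by (induction xss) auto

text \<open>A chain is a list of simplices, each a list of vertices; identities between boundaries are
  stated dually, against an arbitrary cochain.\<close>

fun coboundary :: "('a list \<Rightarrow> bit) \<Rightarrow> 'a list \<Rightarrow> bit" where
  "coboundary a [] = 0"
| "coboundary a (x # xs) = a xs + coboundary (\<lambda>ys. a (x # ys)) xs"

lemma coboundary_add:
  "coboundary (\<lambda>ys. a ys + b ys) xs = coboundary a xs + coboundary b xs"
  by (induction xs arbitrary: a b) (auto simp: algebra_simps)

lemma coboundary_map: "coboundary (\<lambda>ys. a (map f ys)) = (\<lambda>xs. coboundary a (map f xs))"
proof
  show "coboundary (\<lambda>ys. a (map f ys)) xs = coboundary a (map f xs)" for xs
  proof (induction xs arbitrary: a)
    case (Cons x xs)
    from Cons[of "\<lambda>ys. a (f x # ys)"] show ?case by simp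
  qed simp
qed

text \<open>A cochain that ignores the order of vertices has a coboundary that ignores it too, so
  simplices may be sorted first.\<close>

lemma coboundary_mset:
  "coboundary (\<lambda>ys. A (mset ys)) xs = (\<Sum>x\<in>#mset xs. A (mset xs - {#x#}))"
proof (induction xs arbitrary: A)
  case (Cons x xs)
  have "coboundary (\<lambda>ys. A (add_mset x (mset ys))) xs
      = (\<Sum>y\<in>#mset xs. A (add_mset x (mset xs - {#y#})))"
    using Cons[of "\<lambda>M. A (add_mset x M)"] .
  also have "\<dots> = (\<Sum>y\<in>#mset xs. A (add_mset x (mset xs) - {#y#}))"
    by (intro arg_cong[of _ _ sum_mset] image_mset_cong) (auto simp: insert_DiffM2 multiset_eq_iff)
  finally show ?case by simp
qed simp

text \<open>The prism operator of singular homology: for each i, the simplex f x_0, ..., f x_i, g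
  x_i, ..., g x_n.\<close>

fun prism :: "('a \<Rightarrow> 'b) \<Rightarrow> ('a \<Rightarrow> 'b) \<Rightarrow> 'a list \<Rightarrow> 'b list list" where
  "prism f g [] = []"
| "prism f g (x # xs) = (f x # g x # map g xs) # map ((#) (f x)) (prism f g xs)"

lemma length_prism: "ys \<in> set (prism f g xs) \<Longrightarrow> length ys = Suc (length xs)"
  by (induction xs arbitrary: ys) auto

lemma set_prism: "ys \<in> set (prism f g xs) \<Longrightarrow> set ys \<subseteq> f ` set xs \<union> g ` set xs"
  by (induction xs arbitrary: ys) fastforce+

text \<open>The chain homotopy formula modulo two: inner faces of the prism occur twice and cancel,
  leaving bottom, top and the prism over the boundary.\<close>

lemma prism_homotopy:
  fixes f g :: "'a \<Rightarrow> 'b"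
  shows "(\<Sum>ys\<leftarrow>prism f g xs. coboundary a ys)
     = a (map f xs) + a (map g xs) + coboundary (\<lambda>ys. \<Sum>zs\<leftarrow>prism f g ys. a zs) xs"
proof (induction xs arbitrary: a)
  case (Cons x xs)
  define b where "b = (\<lambda>ys. a (f x # ys))"
  define P where "P a ys = (\<Sum>zs\<leftarrow>prism f g ys. a zs)" for a :: "'b list \<Rightarrow> bit" and ys :: "'a list"
  have 1: "P (coboundary a) ys = a (map f ys) + a (map g ys) + coboundary (P a) ys"
    if "ys = xs" for a ys using Cons that by (simp add: P_def [abs_def])
  have P_Cons: "P c (y # ys) = c (f y # g y # map g ys) + P (\<lambda>zs. c (f y # zs)) ys" for c y ys
    by (simp add: P_def o_def)
  have P_add: "P (\<lambda>ys. c ys + d ys) ys = P c ys + P d ys" for c d ys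
    by (simp add: P_def sum_list_addf)
  have "P (coboundary a) (x # xs) =
      b (map g xs) + a (g x # map g xs) + coboundary (\<lambda>ys. a (f x # g x # ys)) (map g xs)
      + (P a xs + P (coboundary b) xs)"
    by (simp add: P_Cons P_add b_def algebra_simps)
  moreover have "coboundary (P a) (x # xs) = P a xs
      + (coboundary (\<lambda>ys. a (f x # g x # ys)) (map g xs) + coboundary (P b) xs)"
    by (simp add: P_Cons coboundary_add b_def coboundary_map[of "\<lambda>ys. a (f x # g x # ys)"])
  ultimately have "P (coboundary a) (x # xs)
      = a (map f (x # xs)) + a (map g (x # xs)) + coboundary (P a) (x # xs)"
    by (simp add: 1 b_def ac_simps)
  then show ?case by (simp only: P_def [abs_def])
qed simp

section \<open>Alternating sign sequences as cochains\<close>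

fun alternating :: "bool \<Rightarrow> bool list \<Rightarrow> bool" where
  "alternating p [] \<longleftrightarrow> True"
| "alternating p (x # xs) \<longleftrightarrow> x = p \<and> alternating (\<not> p) xs"

lemma coboundary_zero [simp]: "coboundary (\<lambda>ys. 0) xs = 0"
  by (induction xs) auto

text \<open>In an alternating sequence exactly one deletion leaves an alternating sequence starting
  with \<open>p\<close>: that of the last entry if it starts with \<open>p\<close>, of the first
  otherwise. In any other sequence such deletions come in pairs, at two equal neighbouring
  entries.\<close>

lemma coboundary_alternating:
  "coboundary (\<lambda>ys. of_bool (alternating p ys)) xs
     = of_bool (alternating p xs) + of_bool (alternating (\<not> p) xs)"
proof (induction xs arbitrary: p)
  case (Cons x xs)
  show ?case
    by (cases "x = p") (use Cons[of "\<not> p"] in \<open>auto simp: ac_simps\<close>)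
qed simp

definition alt_label :: "bool \<Rightarrow> nat list \<Rightarrow> bit" where
  "alt_label p l = of_bool (alternating p (map odd (sort l)))"

lemma coboundary_alt_label:
  "coboundary (alt_label p) l = alt_label p l + alt_label (\<not> p) l"
proof -
  define A where
    "A M = (of_bool (alternating p (map odd (sorted_list_of_multiset M))) :: bit)" for M :: "nat multiset"
  have "coboundary (\<lambda>ys. A (mset ys)) l = coboundary (\<lambda>ys. A (mset ys)) (sort l)"
    unfolding coboundary_mset by simp
  moreover have "alt_label p = (\<lambda>ys. A (mset ys))"
    by (simp add: fun_eq_iff A_def alt_label_def sorted_list_of_multiset_mset)
  ultimately have "coboundary (alt_label p) l = coboundary (alt_label p) (sort l)"
    by simp
  also have "\<dots> = coboundary (\<lambda>ys. of_bool (alternating p (map odd ys))) (sort l)"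
  proof -
    \<comment> \<open>Faces of a sorted list are sorted, so the sorting inside
      \<open>alt_label\<close> has no effect on them.\<close>
    have cong: "coboundary a ys = coboundary b ys"
      if "sorted ys" "\<And>zs. sorted zs \<Longrightarrow> set zs \<subseteq> set ys \<Longrightarrow> a zs = b zs"
      for a b :: "nat list \<Rightarrow> bit" and ys
      using that
    proof (induction ys arbitrary: a b)
      case (Cons y ys)
      have "coboundary (\<lambda>zs. a (y # zs)) ys = coboundary (\<lambda>zs. b (y # zs)) ys"
      proof (rule Cons.IH)
        fix zs assume "sorted zs" "set zs \<subseteq> set ys"
        with Cons.prems(1) show "a (y # zs) = b (y # zs)"
          by (intro Cons.prems(2)) auto
      qed (use Cons.prems(1) in simp)
      moreover have "a ys = b ys"
        using Cons.prems(1) by (intro Cons.prems(2)) auto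
      ultimately show ?case by simp
    qed simp
    show ?thesis
      by (rule cong) (simp_all add: alt_label_def sorted_sort_id)
  qed
  also have "\<dots> = alt_label p l + alt_label (\<not> p) l"
    unfolding coboundary_map[of "\<lambda>ys. of_bool (alternating p ys)" odd] coboundary_alternating
    by (simp only: alt_label_def)
  finally show ?thesis .
qed

subsection \<open>Spheres in box complexes\<close>

text \<open>Signed vertices: the positive ones must be joined to all negative ones, so any set of vertices
  of one sign is a simplex.\<close>

definition box_simplex :: "('a \<Rightarrow> 'a \<Rightarrow> bool) \<Rightarrow> 'a set \<Rightarrow> ('a \<times> bool) list \<Rightarrow> bool" where
  "box_simplex E V xs \<longleftrightarrow>
     fst ` set xs \<subseteq> V \<and> (\<forall>u v. (u, True) \<in> set xs \<and> (v, False) \<in> set xs \<longrightarrow> E u v)"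

definition antipode :: "'a \<times> bool \<Rightarrow> 'a \<times> bool" where
  "antipode x = (fst x, \<not> snd x)"

text \<open>The chain is one hemisphere of an antipodal sphere: together with its antipode it is the
  whole sphere, and its boundary is the whole sphere of one dimension less, the equator.\<close>

inductive box_sphere ::
  "('a \<Rightarrow> 'a \<Rightarrow> bool) \<Rightarrow> 'a set \<Rightarrow> nat \<Rightarrow> ('a \<times> bool) list list \<Rightarrow> bool"
  for E V where
  base: "fst x \<in> V \<Longrightarrow> box_sphere E V 0 [[x]]"
| step: "box_sphere E V d h \<Longrightarrow>
    (\<And>xs. xs \<in> set h' \<Longrightarrow> box_simplex E V xs \<and> length xs = Suc (Suc d)) \<Longrightarrow>
    (\<And>a. (\<Sum>xs\<leftarrow>h'. coboundary a xs) = (\<Sum>xs\<leftarrow>h. a xs + a (map antipode xs))) \<Longrightarrow>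
    box_sphere E V (Suc d) h'"

lemma box_sphere_simplex:
  assumes "box_sphere E V d h" "xs \<in> set h"
  shows "box_simplex E V xs" "length xs = Suc d"
  using assms by (cases; auto simp: box_simplex_def)+

lemma antipode_antipode [simp]: "antipode (antipode x) = x"
  by (simp add: antipode_def)

lemma box_simplex_antipode:
  assumes "box_simplex E V xs" "\<And>u v. E u v \<Longrightarrow> E v u"
  shows "box_simplex E V (map antipode xs)"
  using assms unfolding box_simplex_def antipode_def by (fastforce simp: image_iff)

text \<open>The boundary of a hemisphere is antipodally invariant, so it cancels against that of the
  opposite hemisphere.\<close>

lemma box_sphere_cycle:
  assumes "box_sphere E V d h"
  shows "(\<Sum>xs\<leftarrow>h @ map (map antipode) h. coboundary a xs) = 0"
  using assms
proof cases
  case (step d' g)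
  have "(\<Sum>xs\<leftarrow>h. coboundary a (map antipode xs))
      = (\<Sum>xs\<leftarrow>g. a (map antipode xs) + a xs)"
    using step(4)[of "\<lambda>ys. a (map antipode ys)"] by (simp add: coboundary_map o_def)
  with step(4)[of a] show ?thesis by (simp add: o_def add.commute)
qed simp

lemma box_sphere_map:
  assumes "box_sphere E V d h"
    and "\<And>u v. E u v \<Longrightarrow> E' (\<iota> u) (\<iota> v)" "\<iota> ` V \<subseteq> V'"
  shows "box_sphere E' V' d (map (map (apfst \<iota>)) h)"
  using assms(1)
proof induction
  case (base x)
  then show ?case using assms(3) by (auto intro!: box_sphere.base)
next
  case (step d h h')
  show ?case
  proof (rule box_sphere.step[OF step.IH])
    fix xs assume "xs \<in> set (map (map (apfst \<iota>)) h')"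
    then obtain ys where ys: "ys \<in> set h'" "xs = map (apfst \<iota>) ys" by auto
    with step(2)[of ys] assms(2,3) show "box_simplex E' V' xs \<and> length xs = Suc (Suc d)"
      unfolding box_simplex_def by (fastforce simp: image_iff)
  next
    fix a
    have "antipode \<circ> apfst \<iota> = apfst \<iota> \<circ> antipode"
      by (auto simp: antipode_def)
    with step(3)[of "\<lambda>ys. a (map (apfst \<iota>) ys)"]
    show "sum_list (map (coboundary a) (map (map (apfst \<iota>)) h')) =
      (\<Sum>xs\<leftarrow>map (map (apfst \<iota>)) h. a xs + a (map antipode xs))"
      by (simp add: coboundary_map o_def)
  qed
qed

subsection \<open>Fan's parity argument\<close>

text \<open>Sorting these labels sorts the vertices by colour, and the parity of a label is its sign.\<close>

definition signed_label :: "('a \<Rightarrow> nat) \<Rightarrow> 'a \<times> bool \<Rightarrow> nat" where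
  "signed_label f x = 2 * f (fst x) + of_bool (snd x)"

text \<open>An even label and its successor come from one colour with opposite signs. In a box
  simplex such vertices would be adjacent, so a proper colouring never produces both.\<close>

lemma complementary_labels:
  fixes n a b :: nat
  assumes "n = 2 * a + of_bool s" "Suc n = 2 * b + of_bool t" "even n"
  shows "\<not> s" "t" "a = b"
proof -
  show s: "\<not> s" using assms(1,3) by (cases s) auto
  have odd: "odd (2 * b + of_bool t)"
    using assms(2,3) by (metis even_Suc)
  then show t: "t" by (cases t) simp_all
  show "a = b" using assms(1,2) s t by simp
qed

lemma alternating_Not: "alternating p (map Not xs) \<longleftrightarrow> alternating (\<not> p) xs"
  by (induction xs arbitrary: p) auto

text \<open>The antipode exchanges the labels 2a and 2a + 1. As both never occur in one simplex, the
  sorted order is kept and only the parities flip.\<close>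

lemma alt_label_antipode:
  assumes "box_simplex E V xs" "\<And>u v. E u v \<Longrightarrow> f u \<noteq> f v"
  shows "alt_label p (map (signed_label f) (map antipode xs))
       = alt_label (\<not> p) (map (signed_label f) xs)"
proof -
  define \<tau> where "\<tau> n = (if even n then n + 1 else n - 1)" for n :: nat
  define l where "l = map (signed_label f) xs"
  have \<tau>: "map (signed_label f) (map antipode xs) = map \<tau> l"
    by (auto simp: l_def signed_label_def antipode_def \<tau>_def)
  have mono: "\<tau> x \<le> \<tau> y" if xy: "x \<in> set l" "y \<in> set l" "x \<le> y" for x y
  proof (rule ccontr)
    assume "\<not> \<tau> x \<le> \<tau> y"
    then have "even x \<and> y = Suc x"
      using xy(3) by (auto simp: \<tau>_def split: if_splits elim!: evenE oddE)
    moreover obtain u s where "(u, s) \<in> set xs" "x = 2 * f u + of_bool s"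
      using xy(1) by (auto simp: l_def signed_label_def)
    moreover obtain v t where "(v, t) \<in> set xs" "y = 2 * f v + of_bool t"
      using xy(2) by (auto simp: l_def signed_label_def)
    ultimately have "(u, False) \<in> set xs" "(v, True) \<in> set xs" "f u = f v"
      using complementary_labels[of x "f u" s "f v" t] by simp_all
    with assms show False
      by (force simp: box_simplex_def)
  qed
  have "sorted (map \<tau> (sort l))"
    unfolding sorted_map
    by (rule sorted_wrt_mono_rel[OF _ sorted_sort]) (use mono in auto)
  then have "sort (map \<tau> l) = map \<tau> (sort l)"
    by (intro properties_for_sort) simp_all
  moreover have "odd \<circ> \<tau> = Not \<circ> odd"
    by (auto simp: \<tau>_def fun_eq_iff)
  ultimately show ?thesis
    using alternating_Not[of p "map odd (sort l)"]
    unfolding alt_label_def \<tau> by (simp flip: l_def)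
qed

text \<open>The summand is the coboundary of \<open>alt_label True\<close>, so the sum moves to the
  boundary, the lower hemisphere and its antipode. The antipodal terms turn into
  \<open>alt_label False\<close>, which is the sum one dimension below.\<close>

lemma box_sphere_fan:
  assumes "box_sphere E V d h" "\<And>u v. E u v \<Longrightarrow> f u \<noteq> f v"
  shows "(\<Sum>xs\<leftarrow>h. alt_label True (map (signed_label f) xs)
                  + alt_label False (map (signed_label f) xs)) = 1"
  using assms(1)
proof induction
  case (base x)
  show ?case by (auto simp: alt_label_def)
next
  case (step d h h')
  let ?a = "\<lambda>xs. alt_label True (map (signed_label f) xs)"
  have "(\<Sum>xs\<leftarrow>h'. coboundary ?a xs) = (\<Sum>xs\<leftarrow>h. ?a xs + ?a (map antipode xs))"
    by (rule step(3))
  also have "\<dots> = (\<Sum>xs\<leftarrow>h. ?a xs + alt_label False (map (signed_label f) xs))"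
  proof (intro arg_cong[of _ _ sum_list] map_cong refl)
    fix xs assume "xs \<in> set h"
    then have "box_simplex E V xs" using box_sphere_simplex step(1) by blast
    from alt_label_antipode[OF this assms(2), where p = True]
    show "?a xs + ?a (map antipode xs) = ?a xs + alt_label False (map (signed_label f) xs)"
      by simp
  qed
  also have "\<dots> = 1"
    by (rule step.IH)
  moreover have "coboundary ?a xs = alt_label True (map (signed_label f) xs)
      + alt_label False (map (signed_label f) xs)" for xs
    using coboundary_alt_label[of True "map (signed_label f) xs"]
    by (simp only: coboundary_map[of "alt_label True" "signed_label f"] not_True_eq_False)
  ultimately show ?case by (simp only:)
qed

text \<open>Neighbouring labels differ in parity; an equal colour would require 2a followed by 2a +
  1, which is excluded.\<close>

lemma alternating_sorted_colours:
  assumes "alternating p (map odd l)" "sorted l"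
    and "\<And>n. even n \<Longrightarrow> n \<in> set l \<Longrightarrow> Suc n \<notin> set l"
  shows "sorted_wrt (<) (map (\<lambda>n. n div 2) l)"
  using assms
proof (induction l arbitrary: p rule: induct_list012)
  case (3 x y l)
  have "sorted_wrt (<) (map (\<lambda>n. n div 2) (y # l))"
    using 3(3-5) by (intro 3(2)[of "\<not> p"]) auto
  moreover have "x div 2 < y div 2"
  proof -
    have "x \<le> y" "odd x \<noteq> odd y" using 3(3,4) by auto
    moreover have "\<not> (even x \<and> y = Suc x)" using 3(5)[of x] by auto
    ultimately show ?thesis by presburger
  qed
  ultimately show ?case by auto
qed auto

text \<open>A sum equal to 1 has a nonzero term, that is, a simplex whose \<open>Suc d\<close>
  labels alternate in sign and so carry distinct colours.\<close>

theorem box_sphere_colours: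
  assumes sphere: "box_sphere E V d h" and proper: "\<And>u v. E u v \<Longrightarrow> f u \<noteq> f v"
    and bound: "\<And>v. v \<in> V \<Longrightarrow> f v < c"
  shows "Suc d \<le> c"
proof -
  obtain xs p where xs: "xs \<in> set h" "alt_label p (map (signed_label f) xs) = 1"
  proof (rule ccontr)
    assume "\<not> thesis"
    with that have "alt_label p (map (signed_label f) xs) = 0" if "xs \<in> set h" for xs p
      using bit_not_one_iff that by blast
    then have "(\<Sum>xs\<leftarrow>h. alt_label True (map (signed_label f) xs)
                  + alt_label False (map (signed_label f) xs)) = (\<Sum>xs\<leftarrow>h. 0)"
      by (intro arg_cong[of _ _ sum_list] map_cong) simp_all
    with box_sphere_fan[OF sphere proper] show False by simp
  qed
  define l where "l = sort (map (signed_label f) xs)"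
  have simplex: "box_simplex E V xs" "length xs = Suc d"
    using box_sphere_simplex[OF sphere xs(1)] by auto
  have "Suc n \<notin> set l" if n: "even n" "n \<in> set l" for n
  proof
    assume "Suc n \<in> set l"
    then obtain v t where "(v, t) \<in> set xs" "Suc n = 2 * f v + of_bool t"
      by (auto simp: l_def signed_label_def)
    moreover obtain u s where "(u, s) \<in> set xs" "n = 2 * f u + of_bool s"
      using n(2) by (auto simp: l_def signed_label_def)
    ultimately have "(u, False) \<in> set xs" "(v, True) \<in> set xs" "f u = f v"
      using complementary_labels[of n "f u" s "f v" t] n(1) by simp_all
    then show False using simplex proper by (force simp: box_simplex_def)
  qed
  then have "sorted_wrt (<) (map (\<lambda>n. n div 2) l)"
    using xs(2) by (intro alternating_sorted_colours[of p])
      (auto simp: alt_label_def l_def of_bool_def split: if_splits)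
  then have "distinct (map (\<lambda>n. n div 2) l)"
    by (simp add: strict_sorted_iff)
  from distinct_card[OF this] simplex have "card (set (map (\<lambda>n. n div 2) l)) = Suc d"
    unfolding l_def by (simp only: length_map length_sort)
  moreover have "set (map (\<lambda>n. n div 2) l) \<subseteq> {..<c}"
    using simplex bound by (auto simp: l_def signed_label_def box_simplex_def)
  ultimately show ?thesis
    using card_mono[of "{..<c}" "set (map (\<lambda>n. n div 2) l)"] by simp
qed

subsection \<open>Generalised Mycielski graphs\<close>

text \<open>The list \<open>i # v\<close> is the copy of \<open>v\<close> at level \<open>i\<close>, and \<open>[]\<close> is the apex, joined to level \<open>t\<close>.\<close>

definition level_adj :: "nat \<Rightarrow> nat \<Rightarrow> bool" where
  "level_adj i j \<longleftrightarrow> i = 0 \<and> j = 0 \<or> i = Suc j \<or> j = Suc i"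

definition mycielski_verts :: "nat \<Rightarrow> nat list set \<Rightarrow> nat list set" where
  "mycielski_verts t V = insert [] {i # v | i v. i \<le> t \<and> v \<in> V}"

definition mycielski_adj ::
  "nat \<Rightarrow> nat list set \<Rightarrow> (nat list \<Rightarrow> nat list \<Rightarrow> bool) \<Rightarrow> nat list \<Rightarrow> nat list \<Rightarrow> bool" where
  "mycielski_adj t V E x y \<longleftrightarrow>
     (\<exists>i j u v. x = i # u \<and> y = j # v \<and> i \<le> t \<and> j \<le> t \<and> level_adj i j \<and> E u v)
   \<or> (\<exists>v\<in>V. x = [] \<and> y = t # v \<or> x = t # v \<and> y = [])"

definition lift :: "nat \<Rightarrow> nat \<Rightarrow> nat list \<times> bool \<Rightarrow> nat list \<times> bool" where
  "lift p q x = ((if snd x then p else q) # fst x, snd x)"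

lemma mycielski_adj_sym:
  assumes "\<And>u v. E u v \<Longrightarrow> E v u" "mycielski_adj t V E x y"
  shows "mycielski_adj t V E y x"
  using assms unfolding mycielski_adj_def level_adj_def by metis

lemma mycielski_adj_verts:
  assumes "\<And>u v. E u v \<Longrightarrow> u \<in> V \<and> v \<in> V" "mycielski_adj t V E x y"
  shows "x \<in> mycielski_verts t V \<and> y \<in> mycielski_verts t V"
  using assms unfolding mycielski_adj_def mycielski_verts_def by blast

text \<open>All positive levels are adjacent to all negative ones, so vertices from two different
  lifts may be mixed, as happens in a prism.\<close>

lemma box_simplex_lift:
  assumes "box_simplex E V xs" "set ys \<subseteq> lift p q ` set xs \<union> lift p' q' ` set xs"
    and "\<And>i j. i \<in> {p, p'} \<Longrightarrow> j \<in> {q, q'} \<Longrightarrow> level_adj i j \<and> i \<le> t \<and> j \<le> t"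
  shows "box_simplex (mycielski_adj t V E) (mycielski_verts t V) ys"
proof -
  have le: "p \<le> t" "p' \<le> t" "q \<le> t" "q' \<le> t"
    using assms(3)[of p q] assms(3)[of p' q'] by auto
  have "fst y \<in> mycielski_verts t V" if y: "y \<in> set ys" for y
  proof -
    obtain x where "x \<in> set xs" "y = lift p q x \<or> y = lift p' q' x"
      using assms(2) y by blast
    moreover from this have "fst x \<in> V" using assms(1) by (auto simp: box_simplex_def)
    ultimately show ?thesis
      using le by (cases "snd x") (auto simp: mycielski_verts_def lift_def)
  qed
  moreover have "mycielski_adj t V E u v"
    if uv: "(u, True) \<in> set ys" "(v, False) \<in> set ys" for u v
  proof -
    obtain x where x: "x \<in> set xs" "(u, True) = lift p q x \<or> (u, True) = lift p' q' x"
      using assms(2) uv by blast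
    obtain y where y: "y \<in> set xs" "(v, False) = lift p q y \<or> (v, False) = lift p' q' y"
      using assms(2) uv by blast
    have "x = (fst x, True)" "y = (fst y, False)"
      using x y by (auto simp: lift_def prod_eq_iff)
    then have "E (fst x) (fst y)"
      using x(1) y(1) assms(1) unfolding box_simplex_def by metis
    moreover obtain i where "i \<in> {p, p'}" "u = i # fst x"
      using x by (auto simp: lift_def split: if_splits)
    moreover obtain j where "j \<in> {q, q'}" "v = j # fst y"
      using y by (auto simp: lift_def split: if_splits)
    ultimately show ?thesis
      using assms(3)[of i j] unfolding mycielski_adj_def by blast
  qed
  ultimately show ?thesis unfolding box_simplex_def by auto
qed

text \<open>Moving the two signs up alternately, each by two levels at a time, keeps them on adjacent
  levels.\<close>

lemma lift_homotopy:
  assumes X: "\<And>xs. xs \<in> set X \<Longrightarrow> box_simplex E V xs \<and> length xs = Suc d"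
    and cycle: "\<And>a. (\<Sum>xs\<leftarrow>X. coboundary a xs) = 0"
    and "j \<le> t"
  shows "\<exists>Y p q. (p = j \<and> q = j - 1 \<or> p = j - 1 \<and> q = j) \<and>
    (\<forall>ys\<in>set Y. box_simplex (mycielski_adj t V E) (mycielski_verts t V) ys
               \<and> length ys = Suc (Suc d)) \<and>
    (\<forall>a. (\<Sum>ys\<leftarrow>Y. coboundary a ys)
        = (\<Sum>xs\<leftarrow>X. a (map (lift 0 0) xs)) + (\<Sum>xs\<leftarrow>X. a (map (lift p q) xs)))"
  using assms(3)
proof (induction j)
  case 0
  show ?case by (intro exI[of _ "[]"] exI[of _ 0]) simp
next
  case (Suc j)
  then obtain Y p q where pq: "p = j \<and> q = j - 1 \<or> p = j - 1 \<and> q = j"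
    and Y: "\<And>ys. ys \<in> set Y \<Longrightarrow>
        box_simplex (mycielski_adj t V E) (mycielski_verts t V) ys \<and> length ys = Suc (Suc d)"
    and bd: "\<And>a. (\<Sum>ys\<leftarrow>Y. coboundary a ys)
        = (\<Sum>xs\<leftarrow>X. a (map (lift 0 0) xs)) + (\<Sum>xs\<leftarrow>X. a (map (lift p q) xs))"
    by auto
  \<comment> \<open>The sign on level \<open>j\<close> stays and the other jumps from
    \<open>j - 1\<close> to \<open>j + 1\<close>, both adjacent to \<open>j\<close>. At
    \<open>j = 0\<close> the truncated \<open>j - 1\<close> puts both signs on level 0, which is
    adjacent to itself.\<close>
  define p' where "p' = (if p = j then j else Suc j)"
  define q' where "q' = (if p = j then Suc j else j)"
  define Z where "Z = concat (map (prism (lift p q) (lift p' q')) X)"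
  have adj: "level_adj a b \<and> a \<le> t \<and> b \<le> t" if "a \<in> {p, p'}" "b \<in> {q, q'}" for a b
    using that pq Suc.prems by (auto simp: level_adj_def p'_def q'_def split: if_splits)
  have Z: "box_simplex (mycielski_adj t V E) (mycielski_verts t V) ys \<and> length ys = Suc (Suc d)"
    if "ys \<in> set Z" for ys
  proof -
    obtain xs where xs: "xs \<in> set X" "ys \<in> set (prism (lift p q) (lift p' q') xs)"
      using \<open>ys \<in> set Z\<close> by (auto simp: Z_def)
    then show ?thesis
      using box_simplex_lift[OF _ set_prism[OF xs(2)] adj] X[of xs] length_prism[OF xs(2)] by auto
  qed
  \<comment> \<open>As \<open>X\<close> is a cycle, the prism over its boundary contributes
    nothing.\<close>
  have "(\<Sum>ys\<leftarrow>Z. coboundary a ys)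
      = (\<Sum>xs\<leftarrow>X. a (map (lift p q) xs)) + (\<Sum>xs\<leftarrow>X. a (map (lift p' q') xs))" for a
    using cycle by (simp add: Z_def sum_list_map_concat o_def prism_homotopy sum_list_addf)
  then have "(\<Sum>ys\<leftarrow>Y @ Z. coboundary a ys)
      = (\<Sum>xs\<leftarrow>X. a (map (lift 0 0) xs)) + (\<Sum>xs\<leftarrow>X. a (map (lift p' q') xs))" for a
    by (simp add: bd add.assoc)
  moreover have "p' = Suc j \<and> q' = Suc j - 1 \<or> p' = Suc j - 1 \<and> q' = Suc j"
    by (auto simp: p'_def q'_def)
  ultimately show ?case
    using Y Z by (intro exI[of _ "Y @ Z"] exI[of _ p'] exI[of _ q']) auto
qed

text \<open>The new hemisphere is a cylinder from level 0 to level \<open>t\<close> over the whole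
  sphere \<open>X\<close>, closed by a cone at the apex. Its boundary is the copy of
  \<open>X\<close> on level 0, the new equator.\<close>

lemma box_sphere_mycielski:
  assumes "box_sphere E V d h" and sym: "\<And>u v. E u v \<Longrightarrow> E v u"
  shows "\<exists>h'. box_sphere (mycielski_adj t V E) (mycielski_verts t V) (Suc d) h'"
proof -
  let ?E = "mycielski_adj t V E" and ?V = "mycielski_verts t V"
  define X where "X = h @ map (map antipode) h"
  have X: "box_simplex E V xs \<and> length xs = Suc d" if "xs \<in> set X" for xs
    using that box_sphere_simplex[OF assms(1)] box_simplex_antipode[of E V, OF _ sym]
    by (auto simp: X_def)
  have cycle: "(\<Sum>xs\<leftarrow>X. coboundary a xs) = 0" for a
    unfolding X_def by (rule box_sphere_cycle[OF assms(1)])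
  obtain Y p q where pq: "p = t \<and> q = t - 1 \<or> p = t - 1 \<and> q = t"
    and Y: "\<And>ys. ys \<in> set Y \<Longrightarrow> box_simplex ?E ?V ys \<and> length ys = Suc (Suc d)"
    and bd: "\<And>a. (\<Sum>ys\<leftarrow>Y. coboundary a ys)
        = (\<Sum>xs\<leftarrow>X. a (map (lift 0 0) xs)) + (\<Sum>xs\<leftarrow>X. a (map (lift p q) xs))"
    using lift_homotopy[OF X cycle order.refl] by metis
  \<comment> \<open>The apex is joined to level \<open>t\<close> only, so it gets the sign opposite
    to the one that has reached level \<open>t\<close>.\<close>
  define z where "z = ([] :: nat list, p \<noteq> t)"
  define Z where "Z = map (\<lambda>xs. z # map (lift p q) xs) X"
  have Z: "box_simplex ?E ?V ys \<and> length ys = Suc (Suc d)" if ys: "ys \<in> set Z" for ys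
  proof -
    obtain xs where xs: "xs \<in> set X" "ys = z # map (lift p q) xs"
      using ys by (auto simp: Z_def)
    have lifted: "box_simplex ?E ?V (map (lift p q) xs)"
      using X[OF xs(1)] pq
      by (intro box_simplex_lift[of E V xs _ p q p q]) (auto simp: level_adj_def)
    have apex: "?E [] (t # fst x)" "?E (t # fst x) []" if "x \<in> set xs" for x
      using that X[OF xs(1)] by (auto simp: mycielski_adj_def box_simplex_def)
    have "?E u v" if "(u, True) \<in> insert z (set (map (lift p q) xs))"
      "(v, False) \<in> insert z (set (map (lift p q) xs))" for u v
    proof -
      consider "(u, True) = z" "(v, False) \<in> lift p q ` set xs"
        | "(v, False) = z" "(u, True) \<in> lift p q ` set xs"
        | "(u, True) \<in> lift p q ` set xs" "(v, False) \<in> lift p q ` set xs"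
        using \<open>(u, True) \<in> _\<close> \<open>(v, False) \<in> _\<close> by (auto simp: z_def)
      then show ?thesis
      proof cases
        case 1
        then obtain x where "x \<in> set xs" "v = q # fst x" by (auto simp: lift_def)
        with 1 pq apex show ?thesis by (auto simp: z_def)
      next
        case 2
        then obtain x where "x \<in> set xs" "u = p # fst x" by (auto simp: lift_def)
        with 2 pq apex show ?thesis by (auto simp: z_def)
      next
        case 3
        with lifted show ?thesis by (simp add: box_simplex_def)
      qed
    qed
    moreover have "fst ` insert z (set (map (lift p q) xs)) \<subseteq> ?V"
      using lifted by (auto simp: box_simplex_def z_def mycielski_verts_def)
    ultimately have "box_simplex ?E ?V ys"
      unfolding box_simplex_def xs(2) by simp
    then show ?thesis using X xs by simp
  qed
  \<comment> \<open>The cone over a cycle has that cycle as its boundary.\<close>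
  have "(\<Sum>ys\<leftarrow>Z. coboundary a ys) = (\<Sum>xs\<leftarrow>X. a (map (lift p q) xs))" for a
  proof -
    have "(\<Sum>xs\<leftarrow>X. coboundary (\<lambda>ys. a (z # ys)) (map (lift p q) xs)) = 0"
      using cycle[of "\<lambda>ys. a (z # map (lift p q) ys)"]
      by (simp add: coboundary_map[of "\<lambda>ys. a (z # ys)"])
    then show ?thesis by (simp add: Z_def o_def sum_list_addf)
  qed
  then have "(\<Sum>ys\<leftarrow>Y @ Z. coboundary a ys) = (\<Sum>xs\<leftarrow>X. a (map (lift 0 0) xs))" for a
    by (simp add: bd add.assoc)
  moreover have "lift 0 0 = apfst ((#) 0)"
    by (auto simp: lift_def)
  moreover have "box_sphere ?E ?V d (map (map (apfst ((#) 0))) h)"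
    by (rule box_sphere_map[OF assms(1)])
      (auto simp: mycielski_adj_def level_adj_def mycielski_verts_def)
  moreover have "antipode \<circ> apfst ((#) (0 :: nat)) = apfst ((#) 0) \<circ> antipode"
    by (auto simp: antipode_def)
  ultimately have "box_sphere ?E ?V (Suc d) (Y @ Z)"
    using Y Z by (intro box_sphere.step) (auto simp: X_def sum_list_addf o_def)
  then show ?thesis by blast
qed

text \<open>Stated for closed walks instead of cycles, so that it passes back along homomorphisms;
  length 1 excludes loops.\<close>

definition odd_girth_above :: "('a \<Rightarrow> 'a \<Rightarrow> bool) \<Rightarrow> nat \<Rightarrow> bool" where
  "odd_girth_above E m \<longleftrightarrow>
     (\<forall>l w. odd l \<and> l \<le> m \<and> (\<forall>i<l. E (w i) (w (Suc i))) \<longrightarrow> w l \<noteq> w 0)"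

text \<open>An odd closed walk has a step inside level 0 and visits the apex, at height
  \<open>t + 1\<close>. Going up and coming back cost \<open>t + 1\<close> steps each, so there are
  at least \<open>2 * t + 3\<close> steps.\<close>

lemma mycielski_odd_girth:
  assumes "odd_girth_above E (2 * t + 1)"
  shows "odd_girth_above (mycielski_adj t V E) (2 * t + 1)"
  unfolding odd_girth_above_def
proof (intro allI impI notI, elim conjE)
  fix l and w :: "nat \<Rightarrow> nat list"
  assume l: "odd l" "l \<le> 2 * t + 1"
    and walk: "\<forall>i<l. mycielski_adj t V E (w i) (w (Suc i))" and closed: "w l = w 0"
  define height where "height x = (case x of [] \<Rightarrow> Suc t | i # _ \<Rightarrow> i)" for x
  define H where "H i = height (w i)" for i
  have step: "H i = 0 \<and> H (Suc i) = 0 \<or> H i = Suc (H (Suc i)) \<or> H (Suc i) = Suc (H i)"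
    if "i < l" for i
    using walk that by (force simp: mycielski_adj_def level_adj_def H_def height_def)
  have lipschitz: "H i \<le> H j + (j - i) \<and> H j \<le> H i + (j - i)" if "i \<le> j" "j \<le> l" for i j
    using that
  proof (induction j rule: dec_induct)
    case (step n)
    then show ?case using \<open>\<And>i. i < l \<Longrightarrow> _\<close>[of n] by fastforce
  qed simp
  \<comment> \<open>All other steps change the parity of the height, which an odd closed walk cannot
    do throughout.\<close>
  obtain b where b: "b < l" "H b = 0" "H (Suc b) = 0"
  proof (rule ccontr)
    assume "\<not> thesis"
    with that step have alt: "even (H (Suc i)) \<longleftrightarrow> odd (H i)" if "i < l" for i
      using that by (metis even_Suc)
    have "even (H i) \<longleftrightarrow> (even (H 0) \<longleftrightarrow> even i)" if "i \<le> l" for i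
      using that by (induction i) (use alt in auto)
    from this[of l] l(1) closed show False by (simp add: H_def)
  qed
  \<comment> \<open>A walk that avoids the apex projects to an odd closed walk in
    \<open>E\<close>.\<close>
  obtain a where a: "a < l" "w a = []"
  proof (rule ccontr)
    assume "\<not> thesis"
    with that closed b(1) have "w i \<noteq> []" if "i \<le> l" for i
      using that by (cases "i = l") (metis gr_implies_not0 not_gr_zero, metis le_neq_implies_less)
    then have "E (tl (w i)) (tl (w (Suc i)))" if "i < l" for i
      using walk that by (fastforce simp: mycielski_adj_def)
    with l have "tl (w l) \<noteq> tl (w 0)"
      using assms[unfolded odd_girth_above_def, rule_format, of l "\<lambda>i. tl (w i)"] by blast
    with closed show False by simp
  qed
  have "H a = Suc t" "H l = H 0"
    using a closed by (simp_all add: H_def height_def)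
  note H = this
  \<comment> \<open>Of the two arcs between the apex and the level 0 step, one may run through the
    start of the walk and is then measured in two pieces.\<close>
  show False
  proof (cases "a \<le> b")
    case True
    then have "Suc t \<le> b - a" "Suc t \<le> H 0 + a" "H 0 \<le> l - Suc b"
      using lipschitz[of a b] lipschitz[of 0 a] lipschitz[of "Suc b" l] a(1) b H by auto
    then show False using l(2) True b(1) by linarith
  next
    case False
    then have "Suc t \<le> a - Suc b" "Suc t \<le> H l + (l - a)" "H 0 \<le> b"
      using lipschitz[of "Suc b" a] lipschitz[of a l] lipschitz[of 0 b] a(1) b H by auto
    then show False using l(2) H(2) False a(1) by linarith
  qed
qed

section \<open>Iterating the construction with a small total dominating set\<close>

primrec domination_bound :: "nat \<Rightarrow> nat \<Rightarrow> nat" where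
  "domination_bound t 0 = 2"
| "domination_bound t (Suc c) = t * domination_bound t c + 1"

definition dominated_sphere_graph ::
  "nat \<Rightarrow> nat \<Rightarrow> 'a set \<Rightarrow> ('a \<Rightarrow> 'a \<Rightarrow> bool) \<Rightarrow> 'a set \<Rightarrow> bool" where
  "dominated_sphere_graph m d V E D \<longleftrightarrow>
     finite V \<and> V \<noteq> {} \<and> (\<forall>u v. E u v \<longrightarrow> E v u \<and> u \<in> V) \<and>
     odd_girth_above E m \<and> (\<exists>h. box_sphere E V d h) \<and> D \<subseteq> V \<and> (\<forall>v\<in>V. \<exists>x\<in>D. E v x)"

lemma exists_dominated_sphere_graph:
  assumes "t > 0"
  shows "\<exists>(V :: nat list set) E D.
    dominated_sphere_graph (2 * t + 1) (Suc c) V E D \<and> card D \<le> domination_bound t c"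
proof (induction c)
  case 0
  define V :: "nat list set" where "V = {[0], [1]}"
  define E where "E u v \<longleftrightarrow> u \<in> V \<and> v \<in> V \<and> u \<noteq> v" for u v
  have "odd_girth_above E (2 * t + 1)"
    unfolding odd_girth_above_def
  proof (intro allI impI notI, elim conjE)
    fix l and w :: "nat \<Rightarrow> nat list"
    assume "odd l" "w l = w 0" and walk: "\<forall>i<l. E (w i) (w (Suc i))"
    moreover have "w i = w 0 \<longleftrightarrow> even i" if "i \<le> l" for i
      using that
    proof (induction i)
      case (Suc i)
      then have "E (w i) (w (Suc i))" "E (w 0) (w (Suc 0))" using walk by auto
      with Suc show ?case by (auto simp: E_def V_def)
    qed simp
    ultimately show False by blast
  qed
  \<comment> \<open>The box complex of an edge is a circle; this is the half of it from one vertex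
    to its antipode.\<close>
  moreover have "box_sphere E V (Suc 0) [[([0], True), ([1], False)], [([1], False), ([0], False)]]"
    by (rule box_sphere.step[of _ _ _ "[[([0], True)]]"], rule box_sphere.base)
      (auto simp: V_def E_def box_simplex_def antipode_def ac_simps)
  moreover have "\<forall>u v. E u v \<longrightarrow> E v u \<and> u \<in> V" by (auto simp: E_def)
  moreover have "\<forall>v\<in>V. \<exists>x\<in>V. E v x" by (auto simp: E_def V_def)
  moreover have "finite V" "V \<noteq> {}" "card V \<le> domination_bound t 0" by (auto simp: V_def)
  ultimately have "dominated_sphere_graph (2 * t + 1) (Suc 0) V E V \<and> card V \<le> domination_bound t 0"
    unfolding dominated_sphere_graph_def by (meson order.refl)
  then show ?case by blast
next
  case (Suc c)
  then obtain V :: "nat list set" and E D h where V: "finite V" "V \<noteq> {}"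
    and E: "\<And>u v. E u v \<Longrightarrow> E v u" "\<And>u v. E u v \<Longrightarrow> u \<in> V"
    and girth: "odd_girth_above E (2 * t + 1)" and sphere: "box_sphere E V (Suc c) h"
    and D: "D \<subseteq> V" "\<And>v. v \<in> V \<Longrightarrow> \<exists>x\<in>D. E v x" "card D \<le> domination_bound t c"
    unfolding dominated_sphere_graph_def by metis
  let ?E = "mycielski_adj t V E" and ?V = "mycielski_verts t V"
  obtain v0 where v0: "v0 \<in> V" using V by blast
  \<comment> \<open>A vertex on level \<open>i\<close> is dominated from level \<open>i - 1\<close>,
    and truncation lets level 0 dominate itself, so levels below \<open>t\<close> suffice;
    \<open>t # v0\<close> dominates the apex.\<close>
  define D' where "D' = insert (t # v0) ((\<lambda>(i, x). i # x) ` ({..<t} \<times> D))"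
  have fin: "finite D" using V D finite_subset by blast
  have "?V = insert [] ((\<lambda>(i, x). i # x) ` ({..t} \<times> V))"
    by (auto simp: mycielski_verts_def)
  then have "finite ?V" using V by simp
  moreover have "\<forall>u v. ?E u v \<longrightarrow> ?E v u \<and> u \<in> ?V"
    using mycielski_adj_sym[of E] mycielski_adj_verts[of E V] E by blast
  moreover obtain h' where "box_sphere ?E ?V (Suc (Suc c)) h'"
    using box_sphere_mycielski[OF sphere E(1)] by blast
  moreover have "D' \<subseteq> ?V"
    using v0 D(1) by (auto simp: D'_def mycielski_verts_def)
  moreover have "\<exists>x\<in>D'. ?E y x" if "y \<in> ?V" for y
  proof (cases y)
    case Nil
    then show ?thesis using v0 by (auto simp: D'_def mycielski_adj_def)
  next
    case (Cons i v)
    then have v: "v \<in> V" "i \<le> t" using that by (auto simp: mycielski_verts_def)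
    then obtain x where x: "x \<in> D" "E v x" using D(2) by blast
    from x v assms have "(i - 1) # x \<in> D'" by (auto simp: D'_def)
    moreover have "?E y ((i - 1) # x)"
      using x v Cons by (auto simp: mycielski_adj_def level_adj_def)
    ultimately show ?thesis by blast
  qed
  moreover have "card D' \<le> domination_bound t (Suc c)"
  proof -
    have "card D' \<le> Suc (card ((\<lambda>(i, x). i # x) ` ({..<t} \<times> D)))"
      unfolding D'_def by (rule card_insert_le_m1) simp_all
    also have "\<dots> \<le> Suc (card ({..<t} \<times> D))"
      using fin by (intro Suc_le_mono[THEN iffD2] card_image_le) simp
    also have "\<dots> \<le> domination_bound t (Suc c)"
      using D(3) by (simp add: card_cartesian_product)
    finally show ?thesis .
  qed
  moreover have "?V \<noteq> {}" by (auto simp: mycielski_verts_def)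
  ultimately have "dominated_sphere_graph (2 * t + 1) (Suc (Suc c)) ?V ?E D'
      \<and> card D' \<le> domination_bound t (Suc c)"
    unfolding dominated_sphere_graph_def using mycielski_odd_girth[OF girth, of V] by meson
  then show ?case by blast
qed


subsection \<open>The lower bound\<close>

text \<open>An odd cycle in \<open>G\<close> maps to an odd closed walk in \<open>E\<close>.\<close>

lemma free_of_odd_cycles:
  assumes girth: "odd_girth_above E m" and hom: "\<And>x y. {x, y} \<in> edges G \<Longrightarrow> E (p x) (p y)"
  shows "free_of (odd_cycles m) G"
  unfolding free_of_def
proof
  assume "\<exists>H\<in>odd_cycles m. \<exists>S. simple_graph S \<and> subgraph S G \<and> isomorphic H S"
  then obtain l S f where l: "odd l" "l \<le> m" and S: "edges S \<subseteq> edges G"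
    and f: "edges S = (`) f ` edges (cycle_graph l)"
    by (auto simp: odd_cycles_def subgraph_def isomorphic_def)
  have "E (p (f (i mod l))) (p (f (Suc i mod l)))" if "i < l" for i
  proof (rule hom)
    have "{i, Suc i mod l} \<in> edges (cycle_graph l)"
      using that by (auto simp: cycle_graph_def)
    then have "f ` {i, Suc i mod l} \<in> edges G" using S f by blast
    then show "{f (i mod l), f (Suc i mod l)} \<in> edges G" using that by simp
  qed
  with l have "p (f (l mod l)) \<noteq> p (f (0 mod l))"
    using girth[unfolded odd_girth_above_def, rule_format, of l "\<lambda>i. p (f (i mod l))"] by blast
  then show False by simp
qed

text \<open>Adding \<open>s\<close> copies of each vertex of the total dominating set gives every
  vertex degree at least \<open>s\<close>. The result maps homomorphically to the original graph,
  which keeps the odd girth, and contains it, which keeps the chromatic number large.\<close>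

lemma exists_dense_uncolorable_graph:
  assumes "t > 0"
  shows "\<exists>n d. d \<le> domination_bound t c \<and> (\<forall>s. \<exists>G :: nat graph. simple_graph G \<and>
    free_of (odd_cycles (2 * t + 1)) G \<and> \<not> colorable G (Suc c) \<and>
    s \<le> min_degree G \<and> s \<le> card (verts G) \<and> card (verts G) \<le> n + s * d)"
proof -
  obtain V :: "nat list set" and E D h where V: "finite V" "V \<noteq> {}"
    and E: "\<And>u v. E u v \<Longrightarrow> E v u" "\<And>u v. E u v \<Longrightarrow> u \<in> V"
    and girth: "odd_girth_above E (2 * t + 1)" and sphere: "box_sphere E V (Suc c) h"
    and D: "D \<subseteq> V" "\<And>v. v \<in> V \<Longrightarrow> \<exists>x\<in>D. E v x" "card D \<le> domination_bound t c"
    using exists_dominated_sphere_graph[OF assms, of c]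
    unfolding dominated_sphere_graph_def by metis
  have irrefl: "\<not> E v v" for v
    using girth[unfolded odd_girth_above_def, rule_format, of 1 "\<lambda>_. v"] by auto
  have fin: "finite D" using V D finite_subset by blast
  have "\<exists>G :: nat graph. simple_graph G \<and> free_of (odd_cycles (2 * t + 1)) G
      \<and> \<not> colorable G (Suc c) \<and> s \<le> min_degree G \<and> s \<le> card (verts G)
      \<and> card (verts G) \<le> card V + s * card D" for s
  proof -
    \<comment> \<open>Label 0 marks the original vertices and 1 to \<open>s\<close> the copies;
      \<open>tl\<close> is the homomorphism back. Encoding by \<open>to_nat\<close> supplies the
      vertex type of \<open>delta_chi\<close>.\<close>
    define W where "W = (#) 0 ` V \<union> (\<lambda>(i, x). i # x) ` ({1..s} \<times> D)"
    define G where "G = Graph (to_nat ` W)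
      {{to_nat x, to_nat y} | x y. x \<in> W \<and> y \<in> W \<and> E (tl x) (tl y)}"
    have W: "finite W" "W \<noteq> {}" using V fin by (auto simp: W_def)
    have adj: "{to_nat x, to_nat y} \<in> edges G \<longleftrightarrow> x \<in> W \<and> y \<in> W \<and> E (tl x) (tl y)" for x y
      using E(1) by (auto simp: G_def doubleton_eq_iff)
    have edge: "\<exists>(x :: nat list) (y :: nat list). a = to_nat x \<and> b = to_nat y"
      if ab: "{a, b} \<in> edges G" for a b
    proof -
      obtain x y :: "nat list" where "{a, b} = {to_nat x, to_nat y}"
        using ab unfolding G_def by auto
      then show ?thesis by (metis doubleton_eq_iff)
    qed
    have simple: "simple_graph G"
      using W irrefl by (auto simp: simple_graph_def G_def card_insert_if)
    have "free_of (odd_cycles (2 * t + 1)) G"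
    proof (rule free_of_odd_cycles[OF girth])
      show "E (tl (from_nat x)) (tl (from_nat y))" if "{x, y} \<in> edges G" for x y
        using edge[OF that] that adj by auto
    qed
    moreover have "\<not> colorable G (Suc c)"
    proof
      assume "colorable G (Suc c)"
      then obtain f where f: "\<And>v. v \<in> verts G \<Longrightarrow> f v < Suc c"
        "\<And>u v. {u, v} \<in> edges G \<Longrightarrow> f u \<noteq> f v"
        by (auto simp: colorable_def)
      have "Suc (Suc c) \<le> Suc c"
      proof (rule box_sphere_colours[OF sphere])
        show "f (to_nat (0 # u)) \<noteq> f (to_nat (0 # v))" if "E u v" for u v
          using that E(2)[of u v] E(2)[of v u] E(1)[of u v]
          by (intro f(2)) (auto simp: adj W_def)
        show "f (to_nat (0 # v)) < Suc c" if "v \<in> V" for v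
          using that by (intro f(1)) (auto simp: G_def W_def)
      qed
      then show False by simp
    qed
    moreover have deg: "s \<le> degree G a" if a: "a \<in> verts G" for a
    proof -
      obtain x where x: "x \<in> W" "a = to_nat x" using a by (auto simp: G_def)
      then have "tl x \<in> V" using D(1) by (auto simp: W_def)
      then obtain y where y: "y \<in> D" "E (tl x) y" using D(2) by blast
      have "to_nat ` (\<lambda>i. i # y) ` {1..s} \<subseteq> neighbors G a"
      proof -
        have "i # y \<in> W" if "i \<in> {1..s}" for i
          unfolding W_def using that y(1) by (intro UnI2 image_eqI[of _ _ "(i, y)"]) auto
        then show ?thesis using x y by (auto simp: neighbors_def adj)
      qed
      moreover have "finite (neighbors G a)"
        by (rule finite_neighbors[OF simple])
      moreover have "card (to_nat ` (\<lambda>i. i # y) ` {1..s}) = s"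
        by (simp add: card_image inj_on_def)
      ultimately show ?thesis
        using card_mono by (metis degree_eq_card_neighbors[OF simple])
    qed
    moreover have "s \<le> min_degree G"
      unfolding min_degree_def using W deg by (subst Min_ge_iff) (auto simp: G_def)
    moreover have "s \<le> card (verts G)"
    proof -
      obtain a where "a \<in> verts G" using W by (auto simp: G_def)
      then show ?thesis
        using deg[of a] card_mono[OF _ neighbors_subset[OF simple, of a]] simple
        by (auto simp: degree_eq_card_neighbors simple_graph_def)
    qed
    moreover have "card (verts G) \<le> card V + s * card D"
    proof -
      have "card (verts G) = card W"
        by (auto simp: G_def intro!: card_image)
      also have "\<dots> \<le> card ((#) 0 ` V) + card ((\<lambda>(i, x). i # x) ` ({1..s} \<times> D))"
        unfolding W_def by (rule card_Un_le)
      also have "\<dots> \<le> card V + card ({1..s} \<times> D)"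
        using V fin by (intro add_mono card_image_le) auto
      finally show ?thesis by (simp add: card_cartesian_product)
    qed
    ultimately show ?thesis using simple by blast
  qed
  then show ?thesis using D(3) by blast
qed

section \<open>Admissible densities and their infimum\<close>

definition admissible :: "nat graph set \<Rightarrow> nat \<Rightarrow> real set" where
  "admissible \<F> c = {\<alpha> :: real. \<forall>\<epsilon>>0. \<exists>n\<^sub>0. \<forall>G :: nat graph.
     simple_graph G \<and> card (verts G) \<ge> n\<^sub>0 \<and> free_of \<F> G \<and>
     real (min_degree G) \<ge> (\<alpha> + \<epsilon>) * real (card (verts G))
     \<longrightarrow> colorable G c}"

text \<open>The non-colourable graphs have degree density at least \<open>s / (n + s * d)\<close>,
  which for large \<open>s\<close> exceeds any number below
  \<open>1 / domination_bound t c\<close>.\<close>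

lemma admissible_odd_cycles_lower_bound:
  assumes "t > 0" "\<alpha> \<in> admissible (odd_cycles (2 * t + 1)) (Suc c)"
  shows "1 / real (domination_bound t c) \<le> \<alpha>"
proof (rule ccontr)
  assume "\<not> ?thesis"
  then have \<alpha>: "\<alpha> < 1 / real (domination_bound t c)" by simp
  obtain n d where d: "d \<le> domination_bound t c" and G: "\<And>s. \<exists>G :: nat graph. simple_graph G \<and>
    free_of (odd_cycles (2 * t + 1)) G \<and> \<not> colorable G (Suc c) \<and>
    s \<le> min_degree G \<and> s \<le> card (verts G) \<and> card (verts G) \<le> n + s * d"
    using exists_dense_uncolorable_graph[OF assms(1)] by metis
  define W where "W = real (domination_bound t c)"
  have "domination_bound t c > 0" by (cases c) simp_all
  then have W: "W > 0" by (simp add: W_def)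
  \<comment> \<open>Replacing a negative \<open>\<alpha>\<close> by 0 makes \<open>\<beta>\<close>,
    the midpoint of \<open>\<mu>\<close> and \<open>1 / W\<close>, positive.\<close>
  define \<mu> where "\<mu> = max \<alpha> 0"
  define \<epsilon> where "\<epsilon> = (1 / W - \<mu>) / 2"
  have \<epsilon>: "\<epsilon> > 0" using \<alpha> W by (simp add: \<epsilon>_def \<mu>_def W_def)
  define \<beta> where "\<beta> = \<mu> + \<epsilon>"
  have \<beta>: "\<beta> * W < 1" "\<beta> > 0" "\<alpha> + \<epsilon> \<le> \<beta>"
  proof -
    have "\<beta> = 1 / W - \<epsilon>" unfolding \<beta>_def \<epsilon>_def by (simp add: field_split_simps)
    with \<epsilon> have "\<beta> < 1 / W" by simp
    then show "\<beta> * W < 1" using W by (simp add: field_simps)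
  qed (use \<epsilon> in \<open>auto simp: \<beta>_def \<mu>_def\<close>)
  obtain n0 where n0: "\<And>G :: nat graph. simple_graph G \<Longrightarrow> card (verts G) \<ge> n0 \<Longrightarrow>
     free_of (odd_cycles (2 * t + 1)) G \<Longrightarrow>
     real (min_degree G) \<ge> (\<alpha> + \<epsilon>) * real (card (verts G)) \<Longrightarrow> colorable G (Suc c)"
    using assms(2)[unfolded admissible_def mem_Collect_eq, rule_format, OF \<epsilon>] by blast
  \<comment> \<open>Large enough for \<open>\<beta> * (n + s * W) \<le> s\<close>.\<close>
  define s where "s = max n0 (nat \<lceil>\<beta> * n / (1 - \<beta> * W)\<rceil>)"
  obtain G :: "nat graph" where G: "simple_graph G" "free_of (odd_cycles (2 * t + 1)) G"
    "\<not> colorable G (Suc c)" "s \<le> min_degree G" "s \<le> card (verts G)"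
    "card (verts G) \<le> n + s * d"
    using G by blast
  have "\<beta> * n / (1 - \<beta> * W) \<le> s"
    unfolding s_def by linarith
  then have "\<beta> * n \<le> s * (1 - \<beta> * W)"
    using \<beta> by (simp add: field_simps)
  then have "\<beta> * (n + s * W) \<le> s" by (simp add: algebra_simps)
  have "(\<alpha> + \<epsilon>) * real (card (verts G)) \<le> \<beta> * real (card (verts G))"
    using \<beta> by (intro mult_right_mono) simp_all
  also have "\<dots> \<le> \<beta> * (n + s * W)"
  proof (intro mult_left_mono)
    have "real (card (verts G)) \<le> real (n + s * d)" using G by linarith
    also have "\<dots> \<le> n + s * W"
      using d by (simp add: W_def mult_left_mono)
    finally show "real (card (verts G)) \<le> n + s * W" .
  qed (use \<beta> in simp)
  also have "\<dots> \<le> s" by fact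
  also have "\<dots> \<le> min_degree G" using G by simp
  finally have "colorable G (Suc c)"
    using G by (intro n0) (auto simp: s_def)
  with G show False by simp
qed

subsection \<open>The chromatic profile\<close>

lemma colorable_mono: "colorable G c \<Longrightarrow> c \<le> c' \<Longrightarrow> colorable G c'"
  unfolding colorable_def by (meson less_le_trans)

lemma free_of_mono: "free_of \<F>' G \<Longrightarrow> \<F> \<subseteq> \<F>' \<Longrightarrow> free_of \<F> G"
  unfolding free_of_def by blast

lemma admissible_mono: "\<F> \<subseteq> \<F>' \<Longrightarrow> admissible \<F> c \<subseteq> admissible \<F>' c"
  unfolding admissible_def using free_of_mono by (smt (verit, del_insts) Collect_mono)

lemma one_admissible: "1 \<in> admissible \<F> c"
  unfolding admissible_def
\<comment> \<open>The degree condition cannot be met by a graph with a vertex; the threshold 1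
  excludes the empty graph, whose \<open>min_degree\<close> is unspecified.\<close>
proof (intro CollectI allI impI exI[of _ 1], elim conjE)
  fix \<epsilon> :: real and G :: "nat graph"
  assume \<epsilon>: "\<epsilon> > 0" and G: "simple_graph G" "1 \<le> card (verts G)"
    and md: "(1 + \<epsilon>) * real (card (verts G)) \<le> real (min_degree G)"
  have fin: "finite (verts G)" using G by (simp add: simple_graph_def)
  obtain v where v: "v \<in> verts G" using G(2) by fastforce
  have "min_degree G \<le> degree G v"
    unfolding min_degree_def using v fin by (intro Min_le) auto
  also have "\<dots> \<le> card (verts G)"
    using degree_eq_card_neighbors[OF G(1)] neighbors_subset[OF G(1)] fin by (simp add: card_mono)
  finally have "real (min_degree G) \<le> real (card (verts G))" by simp
  moreover have "real (card (verts G)) < (1 + \<epsilon>) * real (card (verts G))"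
    using \<epsilon> G(2) by simp
  ultimately show "colorable G c" using md by linarith
qed

lemma delta_chi_eq_Inf: "delta_chi \<F> c = Inf (admissible \<F> c)"
  by (simp add: delta_chi_def admissible_def)

text \<open>Together with \<open>one_admissible\<close> this makes \<open>Inf\<close> a genuine
  infimum.\<close>

lemma admissible_bdd_below:
  assumes "\<F> \<subseteq> odd_cycles (2 * t + 1)" "t > 0" "c > 0"
  shows "bdd_below (admissible \<F> c)"
proof (rule bdd_belowI)
  fix \<alpha> assume "\<alpha> \<in> admissible \<F> c"
  then have "\<alpha> \<in> admissible (odd_cycles (2 * t + 1)) (Suc (c - 1))"
    using admissible_mono[OF assms(1)] assms(3) by auto
  then show "1 / real (domination_bound t (c - 1)) \<le> \<alpha>"
    by (rule admissible_odd_cycles_lower_bound[OF assms(2)])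
qed

lemma delta_chi_upper_bound:
  assumes m: "odd m" "m \<ge> 5" and p: "odd p" "p \<ge> 3" "p \<le> Suc c"
    and \<F>: "cycle_graph m \<in> \<F>" "\<F> \<subseteq> odd_cycles m"
  shows "delta_chi \<F> c \<le> 2 * (real p - 1) / (2 * real p * (real p - 1) + 1)"
proof -
  have "(real p + 1) / (real p ^ 2 + real p + 1) \<in> admissible \<F> c"
    unfolding admissible_def
  proof (intro CollectI allI impI)
    fix \<epsilon> :: real assume "\<epsilon> > 0"
    then obtain n0 where n0: "\<And>G :: nat graph. simple_graph G \<and> card (verts G) \<ge> n0 \<and>
      free_of {cycle_graph m} G \<and>
      real (min_degree G) \<ge> ((real p + 1) / (real p ^ 2 + real p + 1) + \<epsilon>) * real (card (verts G))
      \<Longrightarrow> colorable G (p - 1)"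
      using dense_odd_cycle_free_colorable[OF m p(1), of \<epsilon>] p(2) by auto
    have "free_of {cycle_graph m} G" if "free_of \<F> G" for G :: "nat graph"
      using free_of_mono[OF that] \<F>(1) by blast
    then show "\<exists>n0. \<forall>G :: nat graph. simple_graph G \<and> n0 \<le> card (verts G) \<and> free_of \<F> G \<and>
        ((real p + 1) / (real p ^ 2 + real p + 1) + \<epsilon>) * real (card (verts G)) \<le> real (min_degree G)
        \<longrightarrow> colorable G c"
      by (intro exI[of _ n0] allI impI colorable_mono[OF n0]) (use p(3) in auto)
  qed
  moreover have "bdd_below (admissible \<F> c)"
  proof -
    obtain t where "m = 2 * t + 1" using m(1) by (elim oddE)
    then show ?thesis using admissible_bdd_below[of \<F> t c] \<F>(2) m p by auto
  qed
  ultimately have "delta_chi \<F> c \<le> (real p + 1) / (real p ^ 2 + real p + 1)"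
    unfolding delta_chi_eq_Inf by (rule cInf_lower)
  also have "\<dots> \<le> 2 * (real p - 1) / (2 * real p * (real p - 1) + 1)"
  proof -
    \<comment> \<open>The right side minus the left side is \<open>p - 3\<close>.\<close>
    have "(real p + 1) * (2 * real p * (real p - 1) + 1) \<le> 2 * (real p - 1) * (real p ^ 2 + real p + 1)"
      using p(2) by (simp add: algebra_simps power2_eq_square power3_eq_cube)
    moreover have "2 * real p * (real p - 1) + 1 > 0" "real p ^ 2 + real p + 1 > 0"
      using p(2) by (auto intro!: add_nonneg_pos)
    ultimately show ?thesis by (simp add: frac_le_eq divide_le_eq le_divide_eq mult.commute field_simps)
  qed
  finally show ?thesis .
qed

text \<open>The right side is exactly twice the left: it starts at \<open>2 * (2 * t + 1)\<close>
  and obeys the doubled recursion x -> t x + 2, whose inhomogeneous part sums to the geometric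
  quotient.\<close>

lemma domination_bound_le:
  assumes "t \<ge> 2"
  shows "real (domination_bound t (Suc c))
    \<le> 2 * (real t ^ c * (2 * real t + 1) + (real t ^ c - 1) / (real t - 1))"
proof (induction c)
  case (Suc c)
  define T where "T = real t"
  have T: "T - 1 \<noteq> 0" "T \<ge> 0" using assms by (auto simp: T_def)
  have "real (domination_bound t (Suc (Suc c))) = T * real (domination_bound t (Suc c)) + 1"
    by (simp add: T_def algebra_simps)
  also have "\<dots> \<le> T * (2 * (T ^ c * (2 * T + 1) + (T ^ c - 1) / (T - 1))) + 2"
    using Suc T by (intro add_mono mult_left_mono) (auto simp: T_def)
  also have "\<dots> = 2 * (T ^ Suc c * (2 * T + 1) + (T ^ Suc c - 1) / (T - 1))"
    using T by (simp add: field_simps)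
  finally show ?case by (simp only: T_def)
qed simp

theorem theorem1p4:
  fixes k m :: nat
  assumes "k \<ge> 3" and "m = 2 * k - 1"
  shows "(\<forall>c. c \<ge> m - 1 \<longrightarrow>
            delta_chi {cycle_graph m} c
              \<le> 2 * (real m - 1) / (2 * real m * (real m - 1) + 1))
       \<and> (\<forall>c r. c \<ge> 4 \<and> r = 2 * nat \<lfloor>real c / 2\<rfloor> \<longrightarrow>
            delta_chi {cycle_graph 3, cycle_graph 5} c
              \<le> 2 * real r / (2 * real r * (real r + 1) + 1))
       \<and> (\<forall>c. c \<ge> 2 \<longrightarrow>
            delta_chi {cycle_graph m} c \<ge> delta_chi (odd_cycles m) c \<and>
            delta_chi (odd_cycles m) c
              \<ge> 1 / (2 * ((real k - 1) ^ (c - 2) * (2 * real k - 1)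
                         + ((real k - 1) ^ (c - 2) - 1) / (real k - 2))))"
proof (intro conjI allI impI)
  have m: "odd m" "m \<ge> 5" using assms by auto
  have single: "{cycle_graph m} \<subseteq> odd_cycles m" using m by (auto simp: odd_cycles_def)
  show "delta_chi {cycle_graph m} c \<le> 2 * (real m - 1) / (2 * real m * (real m - 1) + 1)"
    if "c \<ge> m - 1" for c
    \<comment> \<open>Here \<open>p\<close> is \<open>m\<close> itself.\<close>
    using delta_chi_upper_bound[OF m m(1) _ _ _ single] m that by simp
  show "delta_chi {cycle_graph 3, cycle_graph 5} c \<le> 2 * real r / (2 * real r * (real r + 1) + 1)"
    if "c \<ge> 4 \<and> r = 2 * nat \<lfloor>real c / 2\<rfloor>" for c r
  proof -
    have "\<lfloor>real c / 2\<rfloor> = int (c div 2)"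
      using floor_divide_of_nat_eq[of c 2, where 'a = real] by simp
    then have r: "r = 2 * (c div 2)" using that by simp
    have "{cycle_graph 3, cycle_graph 5} \<subseteq> odd_cycles 5" by (auto simp: odd_cycles_def)
    \<comment> \<open>Here \<open>p\<close> is \<open>r + 1\<close>, which is odd and at most
      \<open>c + 1\<close>.\<close>
    with r that have "delta_chi {cycle_graph 3, cycle_graph 5} c
        \<le> 2 * (real (Suc r) - 1) / (2 * real (Suc r) * (real (Suc r) - 1) + 1)"
      by (intro delta_chi_upper_bound[of 5]) auto
    moreover have "real (Suc r) - 1 = real r" by simp
    moreover have "2 * real (Suc r) * real r = 2 * real r * (real r + 1)"
      by (simp add: algebra_simps)
    ultimately show ?thesis by (simp only:)
  qed
  fix c :: nat assume c: "c \<ge> 2"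
  define t where "t = k - 1"
  have t: "t \<ge> 2" "m = 2 * t + 1" "real t = real k - 1" using assms by (auto simp: t_def)
  show "delta_chi (odd_cycles m) c \<le> delta_chi {cycle_graph m} c"
    unfolding delta_chi_eq_Inf
  proof (rule cInf_superset_mono)
    show "bdd_below (admissible (odd_cycles m) c)"
      using admissible_bdd_below[of "odd_cycles m" t c] t c by simp
    show "admissible {cycle_graph m} c \<noteq> {}" using one_admissible by blast
  qed (rule admissible_mono[OF single])
  have "1 / (2 * (real t ^ (c - 2) * (2 * real t + 1) + (real t ^ (c - 2) - 1) / (real t - 1)))
      \<le> 1 / real (domination_bound t (Suc (c - 2)))"
  proof (rule frac_le)
    show "0 < real (domination_bound t (Suc (c - 2)))" by (simp add: add_pos_nonneg)
  qed (use domination_bound_le[OF t(1), of "c - 2"] in simp_all)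
  also have "\<dots> \<le> delta_chi (odd_cycles m) c"
    unfolding delta_chi_eq_Inf
  proof (rule cInf_greatest)
    show "admissible (odd_cycles m) c \<noteq> {}" using one_admissible by blast
    fix \<alpha> assume "\<alpha> \<in> admissible (odd_cycles m) c"
    \<comment> \<open>The number of colours is one more than the argument of
      \<open>domination_bound\<close>.\<close>
    moreover have "Suc (Suc (c - 2)) = c" using c by simp
    ultimately have "\<alpha> \<in> admissible (odd_cycles (2 * t + 1)) (Suc (Suc (c - 2)))"
      by (simp only: t(2))
    then show "1 / real (domination_bound t (Suc (c - 2))) \<le> \<alpha>"
      using t(1) by (intro admissible_odd_cycles_lower_bound) simp_all
  qed
  finally show "delta_chi (odd_cycles m) c
      \<ge> 1 / (2 * ((real k - 1) ^ (c - 2) * (2 * real k - 1)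
                 + ((real k - 1) ^ (c - 2) - 1) / (real k - 2)))"
    by (simp add: t(3))
qed

end
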